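(* Let $J\ge1$, let $\Phi_1,\dots,\Phi_J,\Omega\in\mathfrak{g}$ and let $p\geq 1$ be an integer. (a) Suppose that $$\mathrm{coeff}\big(w,\;e^{\Phi_J}\cdots e^{\Phi_1}-e^{\Omega}\big)=0\qquad\text{for all } w\in\bigcup_{q=1}^p\mathcal{W}_q ,$$ i.e. for all Lyndon words $w$ over $\mathcal{A}$ of grade $q\le p$. Then $$e^{\Phi_J}\cdots e^{\Phi_1}-e^\Omega\in\mathcal{R}_{p+1},$$ and more precisely there exist $\Theta\in\mathfrak{g}_{p+1}$ and $R\in\mathcal{R}_{p+2}$ such that $$e^{\Phi_J}\cdots e^{\Phi_1}=e^\Omega+\Theta+R .$$ (b) If the product $e^{\Phi_J}\cdots e^{\Phi_1}$ and $e^{\Omega}$ are both self-adjoint and $p$ is even, then the conclusions of (a) hold already if $\mathrm{coeff}(w,e^{\Phi_J}\cdots e^{\Phi_1}-e^{\Omega})=0$ only for all Lyndon words $w$ over $\mathcal{A}$ of odd grade $q\leq p$.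
   Context: Let $\mathcal{A}$ be one of the following finite alphabets, with grading: either $\mathcal{A}=\{A,B\}$ with $\mathrm{grade}(A)=\mathrm{grade}(B)=1$, or $\mathcal{A}=\{A_1,\dots,A_K\}$ ($K\ge 2$) with $\mathrm{grade}(A_k)=k$. Let $\mathcal{A}^*$ be the set of words over $\mathcal{A}$, including the empty word $\mathrm{Id}$. Let $\mathbb{C}\langle\mathcal{A}\rangle$ be the free associative algebra (non-commutative polynomials) and $\mathbb{C}\langle\langle\mathcal{A}\rangle\rangle$ the algebra of formal power series in the non-commuting variables $\mathcal{A}$; $\mathrm{Id}$ is the multiplicative identity. The grade of a word is the sum of the grades of its letters, and $\mathrm{grade}(\mathrm{Id})=0$. For $w\in\mathcal{A}^*$ and $X\in\mathbb{C}\langle\langle\mathcal{A}\rangle\rangle$, $\mathrm{coeff}(w,X)\in\mathbb{C}$ is the coefficient of the word $w$ in $X$. $\mathfrak{g}\subset\mathbb{C}\langle\mathcal{A}\rangle$ is the free Lie algebra generated by $\mathcal{A}$, with bracket $[X,Y]=XY-YX$. Pure elements of $\mathfrak{g}$ are the iterated commutators with single generators in their slots: every generator is pure, and if $X,Y$ are pure then $[X,Y]$ is pure, with $\mathrm{grade}([X,Y])=\mathrm{grade}(X)+\mathrm{grade}(Y)$. $\mathfrak{g}_k$ is the span of all pure elements of grade $k$, so $\mathfrak{g}=\bigoplus_{k\ge1}\mathfrak{g}_k$ (elements of $\mathfrak{g}$ are finite sums of homogeneous elements). For $q\ge1$, $\mathcal{R}_q\subset\mathbb{C}\langle\langle\mathcal{A}\rangle\rangle$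 is the ideal of all formal power series all of whose terms involve only words of grade $\ge q$. For $X\in\mathbb{C}\langle\langle\mathcal{A}\rangle\rangle$ with zero constant term, $e^X=\sum_{n\ge0}\frac{1}{n!}X^n\in\mathbb{C}\langle\langle\mathcal{A}\rangle\rangle$. Lyndon words: order words lexicographically, with $A<B$, respectively $A_1<\dots<A_K$. A (nonempty) word $w=w_1\cdots w_n$ is a Lyndon word if it is strictly smaller than each of its proper right factors $w_i\cdots w_n$, $i=2,\dots,n$. $\mathcal{W}_q$ denotes the set of Lyndon words over $\mathcal{A}$ of grade $q$. Self-adjointness: for $\Phi=\sum_{k=1}^{m}X_k\in\mathfrak{g}$ with $X_k\in\mathfrak{g}_k$, put $\widetilde{\Phi}=\sum_{k=1}^{m}(-1)^{k+1}X_k$. The adjoint of a product of exponentials is $(e^{\Phi_J}\cdots e^{\Phi_1})^*=e^{\widetilde{\Phi}_1}\cdots e^{\widetilde{\Phi}_J}$ (order reversed), and the product is called self-adjoint if $(e^{\Phi_J}\cdots e^{\Phi_1})^*=e^{\Phi_J}\cdots e^{\Phi_1}$. In particular $e^\Omega$ is self-adjoint if $e^{\widetilde{\Omega}}=e^{\Omega}$. *)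

theory Defs
  imports Complex_Main "HOL-Library.List_Lexorder"
begin

typedef 'a ncseries = "UNIV :: ('a list \<Rightarrow> complex) set"
  morphisms ncs_nth Abs_ncs
  by simp

abbreviation wcoeff :: "'a list \<Rightarrow> 'a ncseries \<Rightarrow> complex" where
  "wcoeff w X \<equiv> ncs_nth X w"

lemma ncs_eq_iff: "X = Y \<longleftrightarrow> (\<forall>w. wcoeff w X = wcoeff w Y)"
  by (metis ncs_nth_inject ext)

instantiation ncseries :: (type) ring_1
begin

definition zero_ncseries where "0 = Abs_ncs (\<lambda>w. 0)"
definition one_ncseries where "1 = Abs_ncs (\<lambda>w. if w = [] then 1 else 0)"
definition plus_ncseries where "X + Y = Abs_ncs (\<lambda>w. wcoeff w X + wcoeff w Y)"
definition uminus_ncseries where "- X = Abs_ncs (\<lambda>w. - wcoeff w X)"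
definition minus_ncseries where "X - Y = Abs_ncs (\<lambda>w. wcoeff w X - wcoeff w Y)"
definition times_ncseries where
  "X * Y = Abs_ncs (\<lambda>w. \<Sum>i\<le>length w. wcoeff (take i w) X * wcoeff (drop i w) Y)"

lemma wcoeff_simps [simp]:
  "wcoeff w 0 = 0"
  "wcoeff w 1 = (if w = [] then 1 else 0)"
  "wcoeff w (X + Y) = wcoeff w X + wcoeff w Y"
  "wcoeff w (- X) = - wcoeff w X"
  "wcoeff w (X - Y) = wcoeff w X - wcoeff w Y"
  by (simp_all add: zero_ncseries_def one_ncseries_def plus_ncseries_def
      uminus_ncseries_def minus_ncseries_def Abs_ncs_inverse)

lemma wcoeff_mult:
  "wcoeff w (X * Y) = (\<Sum>i\<le>length w. wcoeff (take i w) X * wcoeff (drop i w) Y)"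
  by (simp add: times_ncseries_def Abs_ncs_inverse)

instance
proof
  fix X Y Z :: "'a ncseries"
  show "X * Y * Z = X * (Y * Z)"
    unfolding ncs_eq_iff
  proof
    fix w :: "'a list"
    let ?f = "\<lambda>j k. wcoeff (take j w) X * wcoeff (take k (drop j w)) Y * wcoeff (drop (j + k) w) Z"
    have "wcoeff w (X * Y * Z) = (\<Sum>i\<le>length w. \<Sum>j\<le>i. ?f j (i - j))"
      unfolding wcoeff_mult sum_distrib_right
      by (intro sum.cong) (auto simp: min_def drop_take)
    also have "\<dots> = (\<Sum>(j, k)\<in>{(j, k). j + k \<le> length w}. ?f j k)"
      by (rule sum.triangle_reindex_eq [symmetric])
    also have "{(j, k). j + k \<le> length w} = (SIGMA j:{..length w}. {..length w - j})"
      by auto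
    also have "(\<Sum>(j, k)\<in>\<dots>. ?f j k) = (\<Sum>j\<le>length w. \<Sum>k\<le>length w - j. ?f j k)"
      by (rule sum.Sigma [symmetric]) auto
    also have "\<dots> = wcoeff w (X * (Y * Z))"
      unfolding wcoeff_mult sum_distrib_left
      by (intro sum.cong) (auto simp: add.commute mult.assoc)
    finally show "wcoeff w (X * Y * Z) = wcoeff w (X * (Y * Z))" .
  qed
  show "1 * X = X"
    unfolding ncs_eq_iff
  proof
    fix w :: "'a list"
    have "wcoeff w (1 * X) = (\<Sum>i\<le>length w. if i = 0 then wcoeff w X else 0)"
      unfolding wcoeff_mult by (intro sum.cong) auto
    then show "wcoeff w (1 * X) = wcoeff w X" by simp
  qed
  show "X * 1 = X"
    unfolding ncs_eq_iff
  proof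
    fix w :: "'a list"
    have "wcoeff w (X * 1) = (\<Sum>i\<le>length w. if i = length w then wcoeff w X else 0)"
      unfolding wcoeff_mult by (intro sum.cong) auto
    then show "wcoeff w (X * 1) = wcoeff w X" by simp
  qed
  show "(0 :: 'a ncseries) \<noteq> 1"
    unfolding ncs_eq_iff by (auto intro: exI [of _ "[]"])
qed (simp_all add: ncs_eq_iff wcoeff_mult algebra_simps sum.distrib)

end

definition ncs_scale :: "complex \<Rightarrow> 'a ncseries \<Rightarrow> 'a ncseries" where
  "ncs_scale c X = Abs_ncs (\<lambda>w. c * wcoeff w X)"

lemma wcoeff_scale [simp]: "wcoeff w (ncs_scale c X) = c * wcoeff w X"
  by (simp add: ncs_scale_def Abs_ncs_inverse)

global_interpretation ncs: vector_space ncs_scale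
  by unfold_locales (simp_all add: ncs_eq_iff algebra_simps)

definition ncs_word :: "'a list \<Rightarrow> 'a ncseries" where
  "ncs_word v = Abs_ncs (\<lambda>w. if w = v then 1 else 0)"

text \<open>The sum over \<open>n\<close> is taken coefficientwise; for \<open>X\<close> without constant term
  it is finite in every coefficient.\<close>
definition ncs_exp :: "'a ncseries \<Rightarrow> 'a ncseries" where
  "ncs_exp X = Abs_ncs (\<lambda>w. \<Sum>n. wcoeff w (X ^ n) / fact n)"

lemma wcoeff_power_eq_0:
  "wcoeff [] X = 0 \<Longrightarrow> length w < n \<Longrightarrow> wcoeff w (X ^ n) = 0"
proof (induction n arbitrary: w)
  case (Suc n)
  have "wcoeff (take i w) X * wcoeff (drop i w) (X ^ n) = 0" if "i \<le> length w" for i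
    using Suc that by (cases "i = 0") auto
  then show ?case unfolding power_Suc wcoeff_mult by (intro sum.neutral) blast
qed simp

lemma wcoeff_exp:
  assumes "wcoeff [] X = 0"
  shows "wcoeff w (ncs_exp X) = (\<Sum>n\<le>length w. wcoeff w (X ^ n) / fact n)"
  unfolding ncs_exp_def using wcoeff_power_eq_0 [OF assms, of w]
  by (simp add: Abs_ncs_inverse, intro suminf_finite) (auto simp: not_le)

definition lie_bracket :: "'a ncseries \<Rightarrow> 'a ncseries \<Rightarrow> 'a ncseries" where
  "lie_bracket X Y = X * Y - Y * X"

text \<open>Letters are natural numbers: \<open>TwoLetters\<close> is the alphabet \<open>{A, B}\<close> with \<open>A, B\<close>
  encoded as \<open>0, 1\<close>; in \<open>GradedLetters K\<close> the letter \<open>A\<^sub>k\<close> is encoded as \<open>k\<close>. Thus the order of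
  the letters is the order of \<open>nat\<close> in both cases.\<close>
datatype alphabet = TwoLetters | GradedLetters nat

fun valid_alphabet :: "alphabet \<Rightarrow> bool" where
  "valid_alphabet TwoLetters \<longleftrightarrow> True"
| "valid_alphabet (GradedLetters K) \<longleftrightarrow> K \<ge> 2"

fun letters :: "alphabet \<Rightarrow> nat set" where
  "letters TwoLetters = {0, 1}"
| "letters (GradedLetters K) = {1..K}"

fun letter_grade :: "alphabet \<Rightarrow> nat \<Rightarrow> nat" where
  "letter_grade TwoLetters a = 1"
| "letter_grade (GradedLetters K) k = k"

definition word_grade :: "alphabet \<Rightarrow> nat list \<Rightarrow> nat" where
  "word_grade \<A> w = sum_list (map (letter_grade \<A>) w)"

definition series_over :: "alphabet \<Rightarrow> nat ncseries set" where
  "series_over \<A> = {X. \<forall>w. wcoeff w X \<noteq> 0 \<longrightarrow> w \<in> lists (letters \<A>)}"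

definition grade_ideal :: "alphabet \<Rightarrow> nat \<Rightarrow> nat ncseries set" where
  "grade_ideal \<A> q = {X \<in> series_over \<A>. \<forall>w. wcoeff w X \<noteq> 0 \<longrightarrow> word_grade \<A> w \<ge> q}"

text \<open>\<open><\<close> on words is the lexicographic order of \<open>List_Lexorder\<close>, in which a proper prefix of
  a word is smaller than the word.\<close>
definition lyndon_word :: "nat list \<Rightarrow> bool" where
  "lyndon_word w \<longleftrightarrow> w \<noteq> [] \<and> (\<forall>i. 0 < i \<and> i < length w \<longrightarrow> w < drop i w)"

definition lyndon_words :: "alphabet \<Rightarrow> nat \<Rightarrow> nat list set" where
  "lyndon_words \<A> q = {w \<in> lists (letters \<A>). lyndon_word w \<and> word_grade \<A> w = q}"

inductive_set free_lie :: "alphabet \<Rightarrow> nat ncseries set" for \<A> where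
  gen: "a \<in> letters \<A> \<Longrightarrow> ncs_word [a] \<in> free_lie \<A>"
| zero: "0 \<in> free_lie \<A>"
| add: "X \<in> free_lie \<A> \<Longrightarrow> Y \<in> free_lie \<A> \<Longrightarrow> X + Y \<in> free_lie \<A>"
| scale: "X \<in> free_lie \<A> \<Longrightarrow> ncs_scale c X \<in> free_lie \<A>"
| bracket: "X \<in> free_lie \<A> \<Longrightarrow> Y \<in> free_lie \<A> \<Longrightarrow> lie_bracket X Y \<in> free_lie \<A>"

text \<open>The grade is an argument of the predicate because it is a property of the commutator
  expression: the series \<open>0 = [X, X]\<close> is pure of several grades.\<close>
inductive lie_pure :: "alphabet \<Rightarrow> nat \<Rightarrow> nat ncseries \<Rightarrow> bool" for \<A> where
  gen: "a \<in> letters \<A> \<Longrightarrow> lie_pure \<A> (letter_grade \<A> a) (ncs_word [a])"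
| bracket: "lie_pure \<A> k X \<Longrightarrow> lie_pure \<A> l Y \<Longrightarrow> lie_pure \<A> (k + l) (lie_bracket X Y)"

definition free_lie_grade :: "alphabet \<Rightarrow> nat \<Rightarrow> nat ncseries set" where
  "free_lie_grade \<A> k = ncs.span {X. lie_pure \<A> k X}"

text \<open>The decomposition of \<open>\<Phi>\<close> into homogeneous parts exists and is unique for \<open>\<Phi> \<in> free_lie \<A>\<close>
  (\<open>free_lie_decomp\<close>, \<open>lie_tilde_sum\<close> below).\<close>
definition lie_tilde :: "alphabet \<Rightarrow> nat ncseries \<Rightarrow> nat ncseries" where
  "lie_tilde \<A> \<Phi> = (THE \<Psi>. \<exists>m X. (\<forall>k\<in>{1..m}. X k \<in> free_lie_grade \<A> k) \<and>
      \<Phi> = (\<Sum>k=1..m. X k) \<and> \<Psi> = (\<Sum>k=1..m. (- 1) ^ (k + 1) * X k))"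

text \<open>For the list \<open>[\<Phi>\<^sub>1, \<dots>, \<Phi>\<^sub>J]\<close>, the product \<open>e\<^bsup>\<Phi>\<^sub>J\<^esup> \<cdots> e\<^bsup>\<Phi>\<^sub>1\<^esup>\<close>.\<close>
definition exp_product :: "nat ncseries list \<Rightarrow> nat ncseries" where
  "exp_product \<Phi>s = prod_list (map ncs_exp (rev \<Phi>s))"

text \<open>The adjoint is an operation on the given product of exponentials, hence on the list of
  exponents, not on the series that the product evaluates to.\<close>
definition exp_product_adjoint :: "alphabet \<Rightarrow> nat ncseries list \<Rightarrow> nat ncseries" where
  "exp_product_adjoint \<A> \<Phi>s = prod_list (map (\<lambda>\<Phi>. ncs_exp (lie_tilde \<A> \<Phi>)) \<Phi>s)"

definition exp_product_self_adjoint :: "alphabet \<Rightarrow> nat ncseries list \<Rightarrow> bool" where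
  "exp_product_self_adjoint \<A> \<Phi>s \<longleftrightarrow> exp_product_adjoint \<A> \<Phi>s = exp_product \<Phi>s"

lemma exp_product_self_adjoint_single:
  "exp_product_self_adjoint \<A> [\<Omega>] \<longleftrightarrow> ncs_exp (lie_tilde \<A> \<Omega>) = ncs_exp \<Omega>"
  by (simp add: exp_product_self_adjoint_def exp_product_adjoint_def exp_product_def)

lemma wcoeff_sum: "wcoeff w (sum X I) = (\<Sum>i\<in>I. wcoeff w (X i))"
  by (induction I rule: infinite_finite_induct) simp_all

lemma word_grade_take_drop: "word_grade \<A> w = word_grade \<A> (take i w) + word_grade \<A> (drop i w)"
  unfolding word_grade_def by (metis append_take_drop_id map_append sum_list_append)

lemma wcoeff_mult_grade:
  assumes "\<And>w. wcoeff w X \<noteq> 0 \<Longrightarrow> word_grade \<A> w = k"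
    and "\<And>w. wcoeff w Y \<noteq> 0 \<Longrightarrow> word_grade \<A> w = l"
    and "wcoeff w (X * Y) \<noteq> 0"
  shows "word_grade \<A> w = k + l"
proof -
  obtain i where "wcoeff (take i w) X * wcoeff (drop i w) Y \<noteq> 0"
    using assms(3) unfolding wcoeff_mult by (meson sum.neutral)
  then have "word_grade \<A> (take i w) = k" "word_grade \<A> (drop i w) = l"
    using assms(1,2) by auto
  then show ?thesis using word_grade_take_drop by metis
qed

lemma lie_pure_grade: "lie_pure \<A> k X \<Longrightarrow> wcoeff w X \<noteq> 0 \<Longrightarrow> word_grade \<A> w = k"
proof (induction arbitrary: w rule: lie_pure.induct)
  case (gen a)
  then show ?case
    by (auto simp: ncs_word_def Abs_ncs_inverse word_grade_def split: if_splits)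
next
  case (bracket k X l Y)
  then have "wcoeff w (X * Y) \<noteq> 0 \<or> wcoeff w (Y * X) \<noteq> 0"
    by (auto simp: lie_bracket_def)
  then show ?case
    using wcoeff_mult_grade [of X \<A> k Y l w] wcoeff_mult_grade [of Y \<A> l X k w] bracket.IH
    by (auto simp: add.commute)
qed

lemma free_lie_grade_wcoeff:
  assumes "X \<in> free_lie_grade \<A> k" "word_grade \<A> w \<noteq> k"
  shows "wcoeff w X = 0"
  using assms(1) unfolding free_lie_grade_def
proof (induction rule: ncs.span_induct_alt)
  case (step c Y Z)
  then show ?case using assms(2) lie_pure_grade by fastforce
qed simp

lemma lie_tilde_sum:
  assumes "\<And>k. k \<in> {1..m} \<Longrightarrow> X k \<in> free_lie_grade \<A> k"
  shows "lie_tilde \<A> (\<Sum>k=1..m. X k) = (\<Sum>k=1..m. (- 1) ^ (k + 1) * X k)"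
proof -
  have signed: "wcoeff w ((- 1) ^ (k + 1) * Y) = (- 1) ^ (k + 1) * wcoeff w Y"
    for k w and Y :: "nat ncseries"
    by (cases "even k") auto
  have *: "wcoeff w (\<Sum>k=1..n. (- 1) ^ (k + 1) * Y k) =
      (- 1) ^ (word_grade \<A> w + 1) * wcoeff w (\<Sum>k=1..n. Y k)"
    if Y: "\<forall>k\<in>{1..n}. Y k \<in> free_lie_grade \<A> k" for n Y w
    unfolding wcoeff_sum signed sum_distrib_left
  proof (intro sum.cong refl)
    fix k assume "k \<in> {1..n}"
    then show "(- 1) ^ (k + 1) * wcoeff w (Y k) = (- 1) ^ (word_grade \<A> w + 1) * wcoeff w (Y k)"
      using Y free_lie_grade_wcoeff [of "Y k" \<A> k w] by (cases "word_grade \<A> w = k") auto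
  qed
  show ?thesis
    unfolding lie_tilde_def
  proof (rule the_equality)
    show "\<exists>n Y. (\<forall>k\<in>{1..n}. Y k \<in> free_lie_grade \<A> k) \<and> sum X {1..m} = sum Y {1..n} \<and>
        (\<Sum>k=1..m. (- 1) ^ (k + 1) * X k) = (\<Sum>k=1..n. (- 1) ^ (k + 1) * Y k)"
      using assms by blast
  next
    fix \<Psi>
    assume "\<exists>n Y. (\<forall>k\<in>{1..n}. Y k \<in> free_lie_grade \<A> k) \<and> sum X {1..m} = sum Y {1..n} \<and>
        \<Psi> = (\<Sum>k=1..n. (- 1) ^ (k + 1) * Y k)"
    then obtain n Y where "\<forall>k\<in>{1..n}. Y k \<in> free_lie_grade \<A> k" "sum X {1..m} = sum Y {1..n}"
      "\<Psi> = (\<Sum>k=1..n. (- 1) ^ (k + 1) * Y k)"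
      by blast
    then show "\<Psi> = (\<Sum>k=1..m. (- 1) ^ (k + 1) * X k)"
      unfolding ncs_eq_iff using * [of n Y] * [of m X] assms by simp
  qed
qed

lemma lie_bracket_simps:
  "lie_bracket (X + X') Y = lie_bracket X Y + lie_bracket X' Y"
  "lie_bracket Y (X + X') = lie_bracket Y X + lie_bracket Y X'"
  "lie_bracket (ncs_scale c X) Y = ncs_scale c (lie_bracket X Y)"
  "lie_bracket Y (ncs_scale c X) = ncs_scale c (lie_bracket Y X)"
  "lie_bracket 0 Y = 0" "lie_bracket Y 0 = 0"
  by (simp_all add: lie_bracket_def ncs_eq_iff wcoeff_mult algebra_simps sum.distrib sum_distrib_left)

lemma lie_pure_bracket_span:
  assumes "X \<in> ncs.span {X. \<exists>k. lie_pure \<A> k X}" "Y \<in> ncs.span {X. \<exists>k. lie_pure \<A> k X}"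
  shows "lie_bracket X Y \<in> ncs.span {X. \<exists>k. lie_pure \<A> k X}"
  using assms(1)
proof (induction rule: ncs.span_induct_alt)
  case base
  then show ?case by (simp add: lie_bracket_simps ncs.span_zero)
next
  case (step c P Z)
  have "lie_bracket P Y \<in> ncs.span {X. \<exists>k. lie_pure \<A> k X}"
    using assms(2)
  proof (induction rule: ncs.span_induct_alt)
    case base
    then show ?case by (simp add: lie_bracket_simps ncs.span_zero)
  next
    case (step d Q V)
    then have "lie_bracket P Q \<in> {X. \<exists>k. lie_pure \<A> k X}"
      using \<open>P \<in> _\<close> lie_pure.bracket by blast
    then show ?case using step
      by (simp add: lie_bracket_simps ncs.span_add ncs.span_scale ncs.span_base)
  qed
  then show ?case using step by (simp add: lie_bracket_simps ncs.span_add ncs.span_scale)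
qed

lemma lie_pure_grade_pos: "valid_alphabet \<A> \<Longrightarrow> lie_pure \<A> k X \<Longrightarrow> k \<ge> 1"
proof (rotate_tac, induction rule: lie_pure.induct)
  case (gen a)
  then show ?case by (cases \<A>) auto
qed simp

lemma free_lie_decomp:
  assumes "valid_alphabet \<A>" "\<Phi> \<in> free_lie \<A>"
  obtains m X where "\<And>k. k \<in> {1..m} \<Longrightarrow> X k \<in> free_lie_grade \<A> k" "\<Phi> = (\<Sum>k=1..m. X k)"
proof -
  have "\<Phi> \<in> ncs.span {X. \<exists>k. lie_pure \<A> k X}"
    using assms(2)
  proof (induction rule: free_lie.induct)
    case (gen a)
    then show ?case using lie_pure.gen by (intro ncs.span_base) blast
  qed (auto intro: ncs.span_zero ncs.span_add ncs.span_scale lie_pure_bracket_span)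
  then have "\<exists>m X. (\<forall>k. X k \<in> free_lie_grade \<A> k) \<and> (\<forall>k>m. X k = 0) \<and> \<Phi> = (\<Sum>k=1..m. X k)"
  proof (induction rule: ncs.span_induct_alt)
    case base
    then show ?case
      by (intro exI [of _ 0] exI [of _ "\<lambda>_. 0"]) (simp add: free_lie_grade_def ncs.span_zero)
  next
    case (step c P Z)
    then obtain m X l where X: "\<And>k. X k \<in> free_lie_grade \<A> k" "\<And>k. k > m \<Longrightarrow> X k = 0"
        "Z = (\<Sum>k=1..m. X k)" and P: "lie_pure \<A> l P"
      by auto
    have l: "l \<ge> 1" using lie_pure_grade_pos assms(1) P by blast
    let ?W = "\<lambda>k. (if k = l then ncs_scale c P else 0) + X k"
    have "(\<Sum>k=1..max l m. X k) = (\<Sum>k=1..m. X k)"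
      using X(2) by (intro sum.mono_neutral_right) auto
    then have "ncs_scale c P + Z = (\<Sum>k=1..max l m. ?W k)"
      using l X(3) by (simp add: sum.distrib)
    moreover have "?W k \<in> free_lie_grade \<A> k" for k
      using X(1) [of k] P unfolding free_lie_grade_def
      by (auto intro!: ncs.span_add ncs.span_scale intro: ncs.span_base)
    ultimately show ?case using X(2) by (intro exI [of _ "max l m"] exI [of _ ?W]) auto
  qed
  then show thesis using that by blast
qed

end

theory Submission
  imports Defs
begin

text \<open>
  Pair a series with the shuffle product of words. Lie elements vanish on shuffles of nonempty words,
  so their exponentials, and products of these, are multiplicative on shuffles. If two such series
  agree below grade \<open>q\<close>, their difference in grade \<open>q\<close> again vanishes on shuffles of nonempty words.
  A word that is not Lyndon is the lexicographically largest shuffle of a suitable prefix and suffix,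
  so such a difference vanishes in grade \<open>q\<close> as soon as it vanishes on the Lyndon words (Radford);
  in any case it is a Lie element, by the theorem of Dynkin, Specht and Wever. For the self-adjoint case,
  let \<open>\<sigma>\<close> multiply each word by \<open>- 1\<close> to the power of its grade. Then \<open>\<Phi>\<close> with alternating
  signs is \<open>- \<sigma> \<Phi>\<close>, self-adjointness of \<open>P\<close> says \<open>P * \<sigma> P = 1\<close>, and comparing this equation for
  both series in an even grade \<open>q\<close> shows that twice their difference vanishes there.
\<close>

section \<open>Shuffles\<close>

text \<open>A list and not the set \<open>shuffles u v\<close>, because multiplicities count:
  \<open>[a]\<close> shuffled with itself is twice \<open>[a, a]\<close>.\<close>

fun shuffle_list :: "'a list \<Rightarrow> 'a list \<Rightarrow> 'a list list" where
  "shuffle_list [] v = [v]"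
| "shuffle_list u [] = [u]"
| "shuffle_list (a # u) (b # v) =
     map ((#) a) (shuffle_list u (b # v)) @ map ((#) b) (shuffle_list (a # u) v)"

text \<open>\<open>f\<close> is an arbitrary function so that the recursion on the first letter can
  pass to \<open>\<lambda>w. f (a # w)\<close>.\<close>

definition shuffle_sum :: "('a list \<Rightarrow> complex) \<Rightarrow> 'a list \<Rightarrow> 'a list \<Rightarrow> complex" where
  "shuffle_sum f u v = (\<Sum>w\<leftarrow>shuffle_list u v. f w)"

lemma shuffle_sum_simps [simp]:
  "shuffle_sum f [] v = f v"
  "shuffle_sum f u [] = f u"
  "shuffle_sum f (a # u) (b # v) =
     shuffle_sum (\<lambda>w. f (a # w)) u (b # v) + shuffle_sum (\<lambda>w. f (b # w)) (a # u) v"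
  by (cases u; simp add: shuffle_sum_def o_def)+

lemma set_shuffle_list: "set (shuffle_list u v) = shuffles u v"
  by (induction u v rule: shuffle_list.induct) auto

lemma shuffle_sum_cong:
  "(\<And>w. w \<in> shuffles u v \<Longrightarrow> f w = g w) \<Longrightarrow> shuffle_sum f u v = shuffle_sum g u v"
  unfolding shuffle_sum_def set_shuffle_list [symmetric] by (metis map_cong)

lemma shuffle_sum_linear:
  "shuffle_sum (\<lambda>w. f w + g w) u v = shuffle_sum f u v + shuffle_sum g u v"
  "shuffle_sum (\<lambda>w. f w - g w) u v = shuffle_sum f u v - shuffle_sum g u v"
  "shuffle_sum (\<lambda>w. c * f w) u v = c * shuffle_sum f u v"
  "shuffle_sum (\<lambda>w. f w * c) u v = shuffle_sum f u v * c"
  "shuffle_sum (\<lambda>w. f w / c) u v = shuffle_sum f u v / c"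
  by (simp_all add: shuffle_sum_def sum_list_addf sum_list_subtractf sum_list_const_mult
      sum_list_mult_const divide_inverse)

lemma shuffle_sum_sum:
  "shuffle_sum (\<lambda>w. \<Sum>i\<in>I. f i w) u v = (\<Sum>i\<in>I. shuffle_sum (f i) u v)"
proof (induction I rule: infinite_finite_induct)
  case empty
  then show ?case by (simp add: shuffle_sum_def)
next
  case (infinite I)
  then show ?case by (simp add: shuffle_sum_def)
next
  case (insert i I)
  then show ?case by (simp add: shuffle_sum_linear)
qed

text \<open>Cutting a shuffle of \<open>u\<close> and \<open>v\<close> in two amounts to cutting
  \<open>u\<close> and \<open>v\<close> and shuffling the front parts and the back parts
  separately.\<close>

lemma shuffle_sum_conv:
  fixes f g :: "'a list \<Rightarrow> complex"
  shows "shuffle_sum (\<lambda>w. \<Sum>i\<le>length w. f (take i w) * g (drop i w)) u v =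
    (\<Sum>i\<le>length u. \<Sum>j\<le>length v.
       shuffle_sum f (take i u) (take j v) * shuffle_sum g (drop i u) (drop j v))"
proof (induction u v arbitrary: f g rule: shuffle_list.induct)
  case (3 a u b v)
  note IH = "3.IH"(1) [of "\<lambda>w. f (a # w)" g] "3.IH"(2) [of "\<lambda>w. f (b # w)" g]
  \<comment> \<open>The cut before the first letter is split off; every other cut leaves the first
    letter in the front part, where \<open>f\<close> absorbs it.\<close>
  have "shuffle_sum (\<lambda>w. \<Sum>i\<le>length w. f (take i w) * g (drop i w)) (a # u) (b # v) =
     f [] * shuffle_sum g (a # u) (b # v)
     + (\<Sum>i\<le>length u. \<Sum>j\<le>length (b # v). shuffle_sum (\<lambda>w. f (a # w)) (take i u) (take j (b # v))
            * shuffle_sum g (drop i u) (drop j (b # v)))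
     + (\<Sum>i\<le>length (a # u). \<Sum>j\<le>length v. shuffle_sum (\<lambda>w. f (b # w)) (take i (a # u)) (take j v)
            * shuffle_sum g (drop i (a # u)) (drop j v))"
    by (simp add: sum.atMost_Suc_shift shuffle_sum_linear IH distrib_left
        del: sum.atMost_Suc)
  also have "\<dots> = (\<Sum>i\<le>length (a # u). \<Sum>j\<le>length (b # v). shuffle_sum f (take i (a # u)) (take j (b # v))
            * shuffle_sum g (drop i (a # u)) (drop j (b # v)))"
    by (simp add: sum.atMost_Suc_shift sum.distrib algebra_simps del: sum.atMost_Suc)
  finally show ?case .
qed simp_all

section \<open>Lyndon words\<close>

lemma append_in_shuffles: "u @ v \<in> shuffles u v"
proof (induction u)
  case (Cons a u)
  then show ?case by (auto intro: Cons_in_shuffles_leftI)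
qed simp

text \<open>For the greedy step only a one-letter \<open>p\<close> is needed, but \<open>p\<close> grows in the induction: when the
  first letters of \<open>r\<close> and \<open>s\<close> coincide, that letter of \<open>r\<close> is moved to the end of \<open>p\<close>.\<close>
lemma merge_exchange:
  fixes p r s t :: "'a::linorder list"
  assumes "s \<le> r" "t \<in> shuffles (p @ r) s"
  shows "\<exists>t' \<in> shuffles r (p @ s). t \<le> t'"
  using assms
proof (induction "length p + length r + length s" arbitrary: p r s t rule: less_induct)
  case less
  show ?case
  proof (cases p)
    case Nil
    then show ?thesis using less.prems by auto
  next
    case p: (Cons a q)
    show ?thesis
    proof (cases s)
      case Nil
      then have "t = p @ r" using less.prems by simp
      moreover have "p @ r \<in> shuffles r p"
        using append_in_shuffles shuffles_commutes by metis
      ultimately show ?thesis using Nil by auto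
    next
      case s: (Cons c s')
      then obtain d r' where r: "r = d # r'" using less.prems(1) by (cases r) auto
      have ne: "shuffles x y \<noteq> {}" for x y :: "'a list" using append_in_shuffles by fastforce
      consider t' where "t = a # t'" "t' \<in> shuffles (q @ r) s"
        | t' where "t = c # t'" "t' \<in> shuffles (p @ r) s'"
        using less.prems(2) p s by auto
      then show ?thesis
      proof cases
        case 1
        then obtain t2 where "t2 \<in> shuffles r (q @ s)" "t' \<le> t2"
          using less.hyps [of q r s t'] less.prems p by auto
        then show ?thesis using 1 p r by (intro bexI [of _ "a # t2"]) auto
      next
        case 2
        show ?thesis
        proof (cases "c < d")
          case True
          \<comment> \<open>Starting with \<open>d > c\<close> already makes the word larger,
            whatever follows.\<close>
          obtain t2 where "t2 \<in> shuffles r' (p @ s)" using ne by blast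
          then show ?thesis using 2 True r p by (intro bexI [of _ "d # t2"]) auto
        next
          case False
          then have "c = d" "s' \<le> r'" using less.prems(1) r s by auto
          then obtain t2 where "t2 \<in> shuffles r' ((p @ [c]) @ s')" "t' \<le> t2"
            using less.hyps [of "p @ [c]" r' s' t'] 2 r s by auto
          then show ?thesis using 2 p r s \<open>c = d\<close> by (intro bexI [of _ "d # t2"]) auto
        qed
      qed
    qed
  qed
qed

text \<open>Greedy merging: while the rest of \<open>u\<close> is at least \<open>v\<close>, its
  first letter is at least that of \<open>v\<close>. On a tie, \<open>merge_exchange\<close>
  replaces a shuffle that starts with the letter of \<open>v\<close> by one at least as large that
  starts with the letter of \<open>u\<close>.\<close>

lemma shuffles_le_append:
  fixes u v :: "'a::linorder list"
  assumes "\<And>i. i < length u \<Longrightarrow> v \<le> drop i u" "z \<in> shuffles u v"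
  shows "z \<le> u @ v"
  using assms
proof (induction u arbitrary: z)
  case (Cons a u)
  have IH: "y \<le> u @ v" if "y \<in> shuffles u v" for y
    using Cons.IH Cons.prems(1) [of "Suc i" for i] that by auto
  show ?case
  proof (cases v)
    case (Cons b v')
    have le: "v \<le> a # u" using Cons.prems(1) [of 0] by simp
    consider y where "z = a # y" "y \<in> shuffles u v" | y where "z = b # y" "y \<in> shuffles (a # u) v'"
      using Cons.prems(2) Cons by auto
    then show ?thesis
    proof cases
      case 2
      show ?thesis
      proof (cases "b = a")
        case True
        then obtain y' where "y' \<in> shuffles u v" "y \<le> y'"
          using merge_exchange [of v' u y "[a]"] le 2 Cons by auto
        then show ?thesis using IH 2 True by fastforce
      qed (use 2 le Cons in auto)
    qed (use IH in auto)
  qed (use Cons.prems in auto)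
qed simp

lemma not_lyndon_split:
  assumes "w \<noteq> []" "\<not> lyndon_word w"
  obtains u v where "u \<noteq> []" "v \<noteq> []" "w = u @ v" "\<And>z. z \<in> shuffles u v \<Longrightarrow> z \<le> w"
proof -
  let ?S = "(\<lambda>i. drop i w) ` {..<length w}"
  \<comment> \<open>split off the least suffix, i.e. the last Lyndon factor of \<open>w\<close>\<close>
  define v where "v = Min ?S"
  have fin: "finite ?S" and "?S \<noteq> {}" using assms(1) by auto
  then obtain n where n: "n < length w" "v = drop n w" unfolding v_def using Min_in by blast
  have min: "v \<le> drop i w" if "i < length w" for i
    unfolding v_def using that by (intro Min_le [OF fin]) auto
  obtain i where i: "0 < i" "i < length w" "drop i w \<le> w"
    using assms by (auto simp: lyndon_word_def not_less)
  \<comment> \<open>If \<open>w\<close> were its own least suffix, the suffix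
    \<open>drop i w \<le> w\<close> would equal \<open>w\<close>, against its length.\<close>
  have "n \<noteq> 0"
  proof
    assume "n = 0"
    then have "drop i w = w" using min [of i] i n by auto
    then show False using i by (metis length_drop diff_less less_irrefl less_trans)
  qed
  define u where "u = take n w"
  have w: "w = u @ v" using n u_def by simp
  \<comment> \<open>Unless \<open>x\<close> is a prefix of \<open>y\<close>, the comparison is
    decided at a letter of \<open>x\<close>.\<close>
  have ltapp: "x @ v < y" if "x < y" "\<nexists>s. y = x @ s" for x y :: "nat list"
    using that
  proof (induction x arbitrary: y)
    case (Cons a x)
    then show ?case by (cases y) auto
  qed auto
  \<comment> \<open>Minimality gives \<open>v \<le> drop i u @ v\<close>, so a smaller
    \<open>drop i u\<close> is a prefix of \<open>v\<close>, with remainder \<open>s\<close>. Then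
    \<open>v \<le> s\<close> by minimality and \<open>s \<le> v\<close> by cancelling the prefix,
    although \<open>s\<close> is shorter than \<open>v\<close>.\<close>
  have le: "v \<le> drop i u" if "i < length u" for i
  proof (rule ccontr)
    assume "\<not> v \<le> drop i u"
    then have lt: "drop i u < v" by simp
    have vle: "v \<le> drop i u @ v" using min [of i] that w by simp
    then obtain s where s: "v = drop i u @ s" using ltapp [OF lt] by fastforce
    then have "s = drop (n + length (drop i u)) w" using n(2) by (metis append_eq_conv_conj drop_drop add.commute)
    moreover have "s \<noteq> []" using s lt by auto
    ultimately have "v \<le> s" using min [of "n + length (drop i u)"] by fastforce
    have cancel: "x @ a \<le> x @ b \<longleftrightarrow> a \<le> b" for x a b :: "nat list" by (induction x) auto
    have "s \<le> v" using vle s cancel by metis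
    then have "length s = length v" using \<open>v \<le> s\<close> by simp
    then show False using s that by simp
  qed
  show thesis
  proof (rule that)
    show "u \<noteq> []" "v \<noteq> []" using n \<open>n \<noteq> 0\<close> u_def assms(1) by auto
    show "z \<le> w" if "z \<in> shuffles u v" for z
      unfolding w using le that by (rule shuffles_le_append)
  qed (rule w)
qed

text \<open>Triangularity: let \<open>m\<close> be the least word of \<open>S\<close> with
  \<open>f m \<noteq> 0\<close>, split by \<open>not_lyndon_split\<close>. All other shuffles of the
  two parts are smaller, so the shuffle sum is the multiplicity of \<open>m\<close>, which is
  positive, times \<open>f m\<close>.\<close>

lemma zero_if_zero_on_lyndon:
  fixes f :: "nat list \<Rightarrow> complex"
  assumes fin: "finite S" and ne: "[] \<notin> S"
    and shuf: "\<And>u v. u @ v \<in> S \<Longrightarrow> shuffles u v \<subseteq> S"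
    and zero: "\<And>u v. u @ v \<in> S \<Longrightarrow> u \<noteq> [] \<Longrightarrow> v \<noteq> [] \<Longrightarrow> shuffle_sum f u v = 0"
    and lyn: "\<And>w. w \<in> S \<Longrightarrow> lyndon_word w \<Longrightarrow> f w = 0"
    and "w \<in> S"
  shows "f w = 0"
proof (rule ccontr)
  assume "f w \<noteq> 0"
  define T where "T = {w \<in> S. f w \<noteq> 0}"
  have T: "finite T" "T \<noteq> {}" using fin \<open>w \<in> S\<close> \<open>f w \<noteq> 0\<close> by (auto simp: T_def)
  define m where "m = Min T"
  have m: "m \<in> S" "f m \<noteq> 0" using Min_in [OF T] by (auto simp: T_def m_def)
  have below: "f z = 0" if "z \<in> S" "z < m" for z
    using that Min_le [OF T(1), of z] by (force simp: T_def m_def)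
  obtain u v where uv: "u \<noteq> []" "v \<noteq> []" "m = u @ v" "\<And>z. z \<in> shuffles u v \<Longrightarrow> z \<le> m"
    using not_lyndon_split [of m] lyn [of m] m ne by metis
  have sum: "(\<Sum>z\<leftarrow>zs. f z) = of_nat (count_list zs m) * f m"
    if "\<And>z. z \<in> set zs \<Longrightarrow> z \<noteq> m \<Longrightarrow> f z = 0" for zs
    using that by (induction zs) (auto simp: algebra_simps)
  have "f z = 0" if "z \<in> shuffles u v" "z \<noteq> m" for z
    using below [of z] uv that shuf m(1) by fastforce
  then have "shuffle_sum f u v = of_nat (count_list (shuffle_list u v) m) * f m"
    unfolding shuffle_sum_def by (intro sum) (simp add: set_shuffle_list)
  moreover have "m \<in> set (shuffle_list u v)"
    using uv append_in_shuffles by (simp add: set_shuffle_list) 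
  then have "count_list (shuffle_list u v) m \<noteq> 0" by (simp add: count_list_0_iff)
  ultimately show False using zero [of u v] uv m by simp
qed


section \<open>Primitive and group-like series\<close>

lemma wcoeff_word [simp]: "wcoeff w (ncs_word v) = (if w = v then 1 else 0)"
  by (simp add: ncs_word_def Abs_ncs_inverse)

abbreviation shuffle_coeff :: "'a ncseries \<Rightarrow> 'a list \<Rightarrow> 'a list \<Rightarrow> complex" where
  "shuffle_coeff X \<equiv> shuffle_sum (ncs_nth X)"

lemma shuffle_coeff_linear:
  "shuffle_coeff 0 u v = 0"
  "shuffle_coeff (X + Y) u v = shuffle_coeff X u v + shuffle_coeff Y u v"
  "shuffle_coeff (X - Y) u v = shuffle_coeff X u v - shuffle_coeff Y u v"
  "shuffle_coeff (ncs_scale c X) u v = c * shuffle_coeff X u v"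
proof -
  have eq: "ncs_nth (0 :: 'a ncseries) = (\<lambda>w. 0)" "ncs_nth (X + Y) = (\<lambda>w. ncs_nth X w + ncs_nth Y w)"
    "ncs_nth (X - Y) = (\<lambda>w. ncs_nth X w - ncs_nth Y w)"
    "ncs_nth (ncs_scale c X) = (\<lambda>w. c * ncs_nth X w)"
    by auto
  show "shuffle_coeff 0 u v = 0"
    unfolding eq by (simp add: shuffle_sum_def)
  show "shuffle_coeff (X + Y) u v = shuffle_coeff X u v + shuffle_coeff Y u v"
    "shuffle_coeff (X - Y) u v = shuffle_coeff X u v - shuffle_coeff Y u v"
    "shuffle_coeff (ncs_scale c X) u v = c * shuffle_coeff X u v"
    unfolding eq by (simp_all add: shuffle_sum_linear)
qed

text \<open>The coproduct dual to the shuffle product is multiplicative; it is expanded into the tensors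
  \<open>A k \<otimes> B k\<close> and \<open>C l \<otimes> D l\<close>.\<close>
lemma shuffle_coeff_mult:
  assumes "\<And>u v. shuffle_coeff X u v = (\<Sum>k\<in>K. wcoeff u (A k) * wcoeff v (B k))"
    and "\<And>u v. shuffle_coeff Y u v = (\<Sum>l\<in>L. wcoeff u (C l) * wcoeff v (D l))"
  shows "shuffle_coeff (X * Y) u v =
    (\<Sum>k\<in>K. \<Sum>l\<in>L. wcoeff u (A k * C l) * wcoeff v (B k * D l))"
proof -
  have "shuffle_coeff (X * Y) u v = (\<Sum>i\<le>length u. \<Sum>j\<le>length v.
      shuffle_coeff X (take i u) (take j v) * shuffle_coeff Y (drop i u) (drop j v))"
    unfolding shuffle_sum_conv [symmetric] by (intro shuffle_sum_cong) (rule wcoeff_mult)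
  also have "\<dots> = (\<Sum>i\<le>length u. \<Sum>j\<le>length v. \<Sum>k\<in>K. \<Sum>l\<in>L.
      (wcoeff (take i u) (A k) * wcoeff (drop i u) (C l)) *
      (wcoeff (take j v) (B k) * wcoeff (drop j v) (D l)))"
    unfolding assms sum_product by (intro sum.cong refl) (simp add: mult_ac)
  also have "\<dots> = (\<Sum>i\<le>length u. \<Sum>k\<in>K. \<Sum>l\<in>L. \<Sum>j\<le>length v.
      (wcoeff (take i u) (A k) * wcoeff (drop i u) (C l)) *
      (wcoeff (take j v) (B k) * wcoeff (drop j v) (D l)))"
    by (subst sum.swap, subst (2) sum.swap) (rule refl)
  also have "\<dots> = (\<Sum>k\<in>K. \<Sum>l\<in>L. \<Sum>i\<le>length u. \<Sum>j\<le>length v.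
      (wcoeff (take i u) (A k) * wcoeff (drop i u) (C l)) *
      (wcoeff (take j v) (B k) * wcoeff (drop j v) (D l)))"
    by (subst sum.swap, subst (2) sum.swap) (rule refl)
  also have "\<dots> = (\<Sum>k\<in>K. \<Sum>l\<in>L. wcoeff u (A k * C l) * wcoeff v (B k * D l))"
    unfolding wcoeff_mult sum_product ..
  finally show ?thesis .
qed

text \<open>Dual form of \<open>\<Delta> G = G \<otimes> G\<close>; the constant term excludes
  \<open>G = 0\<close>.\<close>

definition group_like :: "'a ncseries \<Rightarrow> bool" where
  "group_like G \<longleftrightarrow> wcoeff [] G = 1 \<and> (\<forall>u v. shuffle_coeff G u v = wcoeff u G * wcoeff v G)"

text \<open>Dual form of \<open>\<Delta> X = X \<otimes> 1 + 1 \<otimes> X\<close>, whose two terms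
  vanish on a pair of nonempty words.\<close>

definition primitive :: "'a ncseries \<Rightarrow> bool" where
  "primitive X \<longleftrightarrow>
     wcoeff [] X = 0 \<and> (\<forall>u v. u \<noteq> [] \<longrightarrow> v \<noteq> [] \<longrightarrow> shuffle_coeff X u v = 0)"

lemma group_like_one: "group_like 1"
  unfolding group_like_def
proof (intro conjI allI)
  fix u v :: "'a list"
  show "shuffle_coeff 1 u v = wcoeff u 1 * wcoeff v 1"
  proof (cases "u = [] \<or> v = []")
    case False
    then have "shuffle_coeff 1 u v = shuffle_sum (\<lambda>w. 0) u v"
      by (intro shuffle_sum_cong) auto
    then show ?thesis using False by (simp add: shuffle_sum_def)
  qed auto
qed simp

lemma group_like_mult:
  assumes "group_like G" "group_like H"
  shows "group_like (G * H)"
  using assms shuffle_coeff_mult [where X = G and K = "{()}" and A = "\<lambda>_. G" and B = "\<lambda>_. G"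
      and Y = H and L = "{()}" and C = "\<lambda>_. H" and D = "\<lambda>_. H"]
  by (simp add: group_like_def wcoeff_mult [where w = "[]"])

text \<open>Summing over \<open>bool\<close> gives the two tensors \<open>X \<otimes> 1\<close> and
  \<open>1 \<otimes> X\<close> the shape required by \<open>shuffle_coeff_mult\<close>.\<close>

lemma primitive_shuffle_coeff:
  assumes "primitive X"
  shows "shuffle_coeff X u v = (\<Sum>b\<in>UNIV. wcoeff u (if b then X else 1) * wcoeff v (if b then 1 else X))"
  using assms by (cases "u = []"; cases "v = []") (auto simp: primitive_def UNIV_bool)

text \<open>The mixed tensors \<open>X \<otimes> Y + Y \<otimes> X\<close> are the same for
  \<open>X * Y\<close> and \<open>Y * X\<close> and cancel; the others have a factor 1 and vanish on
  nonempty words.\<close>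

lemma primitive_bracket:
  assumes "primitive X" "primitive Y"
  shows "primitive (lie_bracket X Y)"
proof -
  have "shuffle_coeff (lie_bracket X Y) u v = 0" if "u \<noteq> []" "v \<noteq> []" for u v
    using that shuffle_coeff_mult [OF assms [THEN primitive_shuffle_coeff], of u v]
      shuffle_coeff_mult [OF assms(2,1) [THEN primitive_shuffle_coeff], of u v]
    by (simp add: lie_bracket_def shuffle_coeff_linear UNIV_bool)
  then show ?thesis using assms by (simp add: primitive_def lie_bracket_def wcoeff_mult [where w = "[]"])
qed

lemma free_lie_primitive: "X \<in> free_lie \<A> \<Longrightarrow> primitive X"
proof (induction rule: free_lie.induct)
  case (gen a)
  have "shuffle_coeff (ncs_word [a]) u v = 0" if "u \<noteq> []" "v \<noteq> []" for u v
  proof -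
    have "shuffle_coeff (ncs_word [a]) u v = shuffle_sum (\<lambda>w. 0) u v"
    proof (intro shuffle_sum_cong)
      fix w assume "w \<in> shuffles u v"
      then have "length w = length u + length v" by (rule length_shuffles)
      then show "wcoeff w (ncs_word [a]) = 0" using that by (cases u; cases v) auto
    qed
    then show ?thesis by (simp add: shuffle_sum_def)
  qed
  then show ?case by (simp add: primitive_def)
qed (auto simp: primitive_def shuffle_coeff_linear primitive_bracket [unfolded primitive_def])

section \<open>Exponentials of primitive series\<close>

lemma sum_choose_Suc:
  fixes h :: "nat \<Rightarrow> complex"
  shows "(\<Sum>l\<le>n. of_nat (n choose l) * h (Suc l)) + (\<Sum>l\<le>n. of_nat (n choose l) * h l) =
    (\<Sum>k\<le>Suc n. of_nat (Suc n choose k) * h k)"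
proof -
  have "h 0 + (\<Sum>l\<le>n. of_nat (n choose Suc l) * h (Suc l)) = (\<Sum>l\<le>Suc n. of_nat (n choose l) * h l)"
    by (subst sum.atMost_Suc_shift) simp
  also have "\<dots> = (\<Sum>l\<le>n. of_nat (n choose l) * h l)" by simp
  finally show ?thesis
    by (subst sum.atMost_Suc_shift) (simp add: algebra_simps sum.distrib)
qed

text \<open>The binomial theorem for the commuting tensors \<open>X \<otimes> 1\<close> and
  \<open>1 \<otimes> X\<close>. The binomial coefficient sits in the first factor so that
  \<open>shuffle_coeff_mult\<close> applies in the induction.\<close>

lemma shuffle_coeff_power:
  fixes X :: "'a ncseries"
  assumes "primitive X"
  shows "shuffle_coeff (X ^ n) u v =
    (\<Sum>k\<le>n. wcoeff u (ncs_scale (of_nat (n choose k)) (X ^ k)) * wcoeff v (X ^ (n - k)))"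
proof (induction n arbitrary: u v)
  case 0
  have "shuffle_coeff 1 u v = wcoeff u 1 * wcoeff v (1 :: 'a ncseries)"
    using group_like_one unfolding group_like_def by blast
  then show ?case unfolding power_0 by (simp only:) simp
next
  case (Suc n)
  have scale: "wcoeff u (Y * ncs_scale c Z) = c * wcoeff u (Y * Z)" for Y Z :: "'a ncseries" and c
    by (simp add: wcoeff_mult sum_distrib_left mult_ac)
  let ?h = "\<lambda>k. wcoeff u (X ^ k) * wcoeff v (X ^ (Suc n - k))"
  have "shuffle_coeff (X ^ Suc n) u v =
      (\<Sum>l\<le>n. of_nat (n choose l) * ?h (Suc l)) + (\<Sum>l\<le>n. of_nat (n choose l) * ?h l)"
    unfolding power_Suc shuffle_coeff_mult [OF primitive_shuffle_coeff [OF assms] Suc]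
    by (simp add: UNIV_bool scale mult.assoc Suc_diff_le add.commute power_Suc [symmetric]
      del: power_Suc)
  also have "\<dots> = (\<Sum>k\<le>Suc n. of_nat (Suc n choose k) * ?h k)"
    by (rule sum_choose_Suc)
  finally show ?case by (simp add: mult.assoc)
qed

text \<open>A common bound \<open>N\<close> truncates the exponential series of words of different
  lengths alike.\<close>

lemma wcoeff_exp_upto:
  assumes "wcoeff [] X = 0" "length w \<le> N"
  shows "wcoeff w (ncs_exp X) = (\<Sum>n\<le>N. wcoeff w (X ^ n) / fact n)"
  unfolding wcoeff_exp [OF assms(1)]
  using assms by (intro sum.mono_neutral_left) (auto intro!: wcoeff_power_eq_0)

lemma fact_choose_split:
  fixes x y :: complex
  assumes "k \<le> n"
  shows "of_nat (n choose k) * x * y / fact n = x / fact k * (y / fact (n - k))"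
  by (simp add: binomial_fact [OF assms])

lemma group_like_exp:
  assumes "primitive X"
  shows "group_like (ncs_exp X)"
  unfolding group_like_def
proof (intro conjI allI)
  have X0: "wcoeff [] X = 0" using assms by (simp add: primitive_def)
  then show "wcoeff [] (ncs_exp X) = 1" by (simp add: wcoeff_exp)
  fix u v :: "'a list"
  define N where "N = length u + length v"
  let ?h = "\<lambda>k l. wcoeff u (X ^ k) / fact k * (wcoeff v (X ^ l) / fact l)"
  have "shuffle_coeff (ncs_exp X) u v = shuffle_sum (\<lambda>w. \<Sum>n\<le>N. wcoeff w (X ^ n) / fact n) u v"
    by (intro shuffle_sum_cong wcoeff_exp_upto X0) (simp add: length_shuffles N_def)
  also have "\<dots> = (\<Sum>n\<le>N. \<Sum>k\<le>n. ?h k (n - k))"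
    by (simp add: shuffle_sum_sum shuffle_sum_linear shuffle_coeff_power [OF assms]
        sum_divide_distrib fact_choose_split del: times_divide_eq_left times_divide_eq_right)
  also have "\<dots> = (\<Sum>(k, l)\<in>{(k, l). k + l \<le> N}. ?h k l)"
    by (rule sum.triangle_reindex_eq [symmetric])
  \<comment> \<open>By the choice of \<open>N\<close> the rectangle lies in the triangle; outside it
    a power exceeds the length of its word and has coefficient 0.\<close>
  also have "\<dots> = (\<Sum>(k, l)\<in>{..length u} \<times> {..length v}. ?h k l)"
  proof (rule sum.mono_neutral_right)
    show "finite {(k, l). k + l \<le> N}"
      by (rule finite_subset [of _ "{..N} \<times> {..N}"]) auto
    show "\<forall>kl\<in>{(k, l). k + l \<le> N} - {..length u} \<times> {..length v}. (case kl of (k, l) \<Rightarrow> ?h k l) = 0"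
      using wcoeff_power_eq_0 [OF X0] by (auto, (metis not_le)+)
  qed (auto simp: N_def)
  also have "\<dots> = wcoeff u (ncs_exp X) * wcoeff v (ncs_exp X)"
    by (simp add: wcoeff_exp [OF X0] sum_product sum.cartesian_product)
  finally show "shuffle_coeff (ncs_exp X) u v = wcoeff u (ncs_exp X) * wcoeff v (ncs_exp X)" .
qed

lemma exp_minus_mult_exp:
  fixes X :: "'a ncseries"
  assumes X0: "wcoeff [] X = 0"
  shows "ncs_exp (- X) * ncs_exp X = 1"
  unfolding ncs_eq_iff
proof
  fix w :: "'a list"
  define N where "N = length w"
  have mX0: "wcoeff [] (- X) = 0" using X0 by simp
  have mpow: "wcoeff w ((- X) ^ k * Y) = (- 1) ^ k * wcoeff w (X ^ k * Y)" for k Y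
    by (cases "even k") (simp_all add: power_minus_odd)
  let ?h = "\<lambda>k l. (- 1) ^ k * wcoeff w (X ^ (k + l)) / (fact k * fact l)"
  have "wcoeff w (ncs_exp (- X) * ncs_exp X) = (\<Sum>i\<le>length w. (\<Sum>k\<le>N. \<Sum>l\<le>N.
      wcoeff (take i w) ((- X) ^ k) / fact k * (wcoeff (drop i w) (X ^ l) / fact l)))"
    unfolding wcoeff_mult
    by (intro sum.cong refl) (simp add: wcoeff_exp_upto [OF X0, of _ N] wcoeff_exp_upto [OF mX0, of _ N]
        N_def sum_product)
  also have "\<dots> = (\<Sum>k\<le>N. \<Sum>l\<le>N. \<Sum>i\<le>length w.
      wcoeff (take i w) ((- X) ^ k) / fact k * (wcoeff (drop i w) (X ^ l) / fact l))"
    by (subst sum.swap, subst (2) sum.swap) (rule refl)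
  also have "\<dots> = (\<Sum>k\<le>N. \<Sum>l\<le>N. ?h k l)"
  proof (intro sum.cong refl)
    fix k l
    have "(\<Sum>i\<le>length w. wcoeff (take i w) ((- X) ^ k) / fact k * (wcoeff (drop i w) (X ^ l) / fact l))
        = wcoeff w ((- X) ^ k * X ^ l) / (fact k * fact l)"
      by (simp add: wcoeff_mult sum_divide_distrib)
    then show "(\<Sum>i\<le>length w. wcoeff (take i w) ((- X) ^ k) / fact k * (wcoeff (drop i w) (X ^ l) / fact l))
        = ?h k l"
      by (simp add: mpow power_add)
  qed
  also have "\<dots> = (\<Sum>(k, l)\<in>{..N} \<times> {..N}. ?h k l)"
    by (simp add: sum.cartesian_product)
  \<comment> \<open>Here the square contains the triangle, and \<open>X ^ (k + l)\<close> has no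
    word of length \<open>N < k + l\<close>.\<close>
  also have "\<dots> = (\<Sum>(k, l)\<in>{(k, l). k + l \<le> N}. ?h k l)"
    using wcoeff_power_eq_0 [OF X0, of w]
    by (intro sum.mono_neutral_right) (auto simp: N_def, meson not_le)
  also have "\<dots> = (\<Sum>n\<le>N. \<Sum>k\<le>n. ?h k (n - k))"
    by (rule sum.triangle_reindex_eq)
  also have "\<dots> = (\<Sum>n\<le>N. wcoeff w (X ^ n) / fact n * (\<Sum>k\<le>n. (- 1) ^ k * of_nat (n choose k)))"
    unfolding sum_distrib_left by (intro sum.cong refl) (simp add: binomial_fact)
  \<comment> \<open>The inner sum is the expansion of \<open>(1 - 1) ^ n\<close>.\<close>
  also have "\<dots> = (\<Sum>n\<le>N. if n = 0 then wcoeff w 1 else 0)"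
    by (intro sum.cong refl) (auto simp: choose_alternating_sum)
  finally show "wcoeff w (ncs_exp (- X) * ncs_exp X) = wcoeff w 1" by simp
qed


section \<open>Lie elements from iterated brackets\<close>

lemma wcoeff_mult_letter:
  "wcoeff w (X * ncs_word [a]) = (if w \<noteq> [] \<and> last w = a then wcoeff (butlast w) X else 0)"
proof (cases w rule: rev_cases)
  case (snoc v b)
  have "wcoeff w (X * ncs_word [a]) = (\<Sum>i\<le>Suc (length v). 
      if i = length v then (if b = a then wcoeff v X else 0) else 0)"
    unfolding wcoeff_mult
  proof (intro sum.cong)
    fix i assume i: "i \<in> {..Suc (length v)}"
    show "wcoeff (take i w) X * wcoeff (drop i w) (ncs_word [a]) =
        (if i = length v then (if b = a then wcoeff v X else 0) else 0)"
    proof (cases "i = length v")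
      case False
      then have "length (drop i w) \<noteq> length [a]" using i snoc by auto
      then have "drop i w \<noteq> [a]" by metis
      then show ?thesis using False by simp
    qed (use snoc in simp)
  qed (use snoc in simp)
  then show ?thesis using snoc by simp
qed (simp add: wcoeff_mult)

lemma wcoeff_letter_mult:
  "wcoeff w (ncs_word [a] * X) = (if w \<noteq> [] \<and> hd w = a then wcoeff (tl w) X else 0)"
proof (cases w)
  case (Cons b v)
  have "wcoeff w (ncs_word [a] * X) = (\<Sum>i\<le>Suc (length v). 
      if i = Suc 0 then (if b = a then wcoeff v X else 0) else 0)"
    unfolding wcoeff_mult
  proof (intro sum.cong)
    fix i assume i: "i \<in> {..Suc (length v)}"
    show "wcoeff (take i w) (ncs_word [a]) * wcoeff (drop i w) X =
        (if i = Suc 0 then (if b = a then wcoeff v X else 0) else 0)"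
    proof (cases "i = Suc 0")
      case False
      then have "length (take i w) \<noteq> length [a]" using i Cons by auto
      then have "take i w \<noteq> [a]" by metis
      then show ?thesis using False by simp
    qed (use Cons in simp)
  qed (use Cons in simp)
  then show ?thesis using Cons by (simp add: sum.delta del: sum.atMost_Suc)
qed (simp add: wcoeff_mult)

text \<open>The sum of \<open>f (a\<^sub>1 \<cdots> a\<^sub>n)\<close> times \<open>[\<dots>[[X, a\<^sub>1], a\<^sub>2], \<dots>, a\<^sub>n]\<close> over all words of length \<open>n\<close> over \<open>A\<close>.\<close>
fun bracket_sum :: "'a set \<Rightarrow> nat \<Rightarrow> ('a list \<Rightarrow> complex) \<Rightarrow> 'a ncseries \<Rightarrow> 'a ncseries" where
  "bracket_sum A 0 f X = ncs_scale (f []) X"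
| "bracket_sum A (Suc n) f X =
     (\<Sum>a\<in>A. bracket_sum A n (\<lambda>w. f (a # w)) (lie_bracket X (ncs_word [a])))"

text \<open>Bracketing with a letter lengthens words by one; this keeps bracket sums for different
  \<open>n\<close> apart.\<close>

lemma bracket_sum_homogeneous:
  assumes "\<And>w. wcoeff w X \<noteq> 0 \<Longrightarrow> length w = k" "wcoeff v (bracket_sum A n f X) \<noteq> 0"
  shows "length v = k + n"
  using assms
proof (induction n arbitrary: k f X)
  case (Suc n)
  obtain a where a: "wcoeff v (bracket_sum A n (\<lambda>w. f (a # w)) (lie_bracket X (ncs_word [a]))) \<noteq> 0"
    using Suc.prems(2) by (auto simp: wcoeff_sum elim: sum.not_neutral_contains_not_neutral)
  have "length w = Suc k" if "wcoeff w (lie_bracket X (ncs_word [a])) \<noteq> 0" for w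
  proof -
    have "w \<noteq> []" "wcoeff (butlast w) X \<noteq> 0 \<or> wcoeff (tl w) X \<noteq> 0"
      using that by (auto simp: lie_bracket_def wcoeff_mult_letter wcoeff_letter_mult split: if_splits)
    then show ?thesis using Suc.prems(1) [of "butlast w"] Suc.prems(1) [of "tl w"] by (cases w) auto
  qed
  then show ?case using Suc.IH [OF _ a] by simp
qed auto

lemma bracket_sum_free_lie_grade:
  assumes "lie_pure \<A> k X" "A \<subseteq> letters \<A>" "\<And>w. f w \<noteq> 0 \<Longrightarrow> k + word_grade \<A> w = q"
  shows "bracket_sum A n f X \<in> free_lie_grade \<A> q"
  using assms
proof (induction n arbitrary: k f X)
  case 0
  then show ?case
    using 0(3) [of "[]"] by (cases "f [] = 0")
      (auto simp: free_lie_grade_def word_grade_def intro: ncs.span_zero ncs.span_scale ncs.span_base)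
next
  case (Suc n)
  have "bracket_sum A n (\<lambda>w. f (a # w)) (lie_bracket X (ncs_word [a])) \<in> free_lie_grade \<A> q"
    if "a \<in> A" for a
  proof (rule Suc.IH)
    show "lie_pure \<A> (k + letter_grade \<A> a) (lie_bracket X (ncs_word [a]))"
      using Suc.prems that by (auto intro: lie_pure.intros)
    show "k + letter_grade \<A> a + word_grade \<A> w = q" if "f (a # w) \<noteq> 0" for w
      using Suc.prems(3) [OF that] by (simp add: word_grade_def)
  qed fact
  then show ?case unfolding free_lie_grade_def by (auto intro: ncs.span_sum)
qed

lemma shuffle_sum_expand:
  assumes "x \<noteq> [] \<or> y \<noteq> []"
  shows "shuffle_sum f x y =
    (if x = [] then 0 else shuffle_sum (\<lambda>w. f (hd x # w)) (tl x) y) +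
    (if y = [] then 0 else shuffle_sum (\<lambda>w. f (hd y # w)) x (tl y))"
  using assms by (cases x; cases y) auto

text \<open>Expanding the brackets puts each letter to the right of \<open>X\<close>, or to the left
  with a minus sign. The \<open>i\<close> letters on the left appear in reversed order, so the
  letter sequences that produce \<open>v\<close> are the shuffles of its reversed left part with its
  right part.\<close>

lemma wcoeff_bracket_sum:
  assumes "finite A" "set v \<subseteq> A" "length v = k + n"
  shows "wcoeff v (bracket_sum A n f X) =
    (\<Sum>i\<le>n. (- 1) ^ i * wcoeff (take k (drop i v)) X * shuffle_sum f (rev (take i v)) (drop (i + k) v))"
  using assms(3)
proof (induction n arbitrary: k f X)
  case (Suc n)
  let ?T = "\<lambda>i a. shuffle_sum (\<lambda>w. f (a # w)) (rev (take i v)) (drop (Suc (i + k)) v)"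
  \<comment> \<open>The innermost bracket places \<open>a\<close> at the end or at the start of the
    window of length \<open>Suc k\<close>.\<close>
  have last: "wcoeff (take (Suc k) (drop i v)) (lie_bracket X (ncs_word [a])) =
      (if a = v ! (i + k) then wcoeff (take k (drop i v)) X else 0) -
      (if a = v ! i then wcoeff (take k (drop (Suc i) v)) X else 0)" if "i \<le> n" for i a
  proof -
    define m where "m = take (Suc k) (drop i v)"
    have "m = take k (drop i v) @ [v ! (i + k)]"
      unfolding m_def using Suc.prems that by (simp add: take_Suc_conv_app_nth)
    then have 1: "last m = v ! (i + k)" "butlast m = take k (drop i v)"
      by simp_all
    have "m = v ! i # take k (drop (Suc i) v)"
      unfolding m_def using Suc.prems that by (simp add: Cons_nth_drop_Suc [symmetric])
    then have 2: "hd m = v ! i" "tl m = take k (drop (Suc i) v)" "m \<noteq> []"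
      by simp_all
    show ?thesis
      unfolding m_def [symmetric] lie_bracket_def wcoeff_simps wcoeff_mult_letter wcoeff_letter_mult 1 2
      using 2(3) by auto
  qed
  have "wcoeff v (bracket_sum A (Suc n) f X) = (\<Sum>a\<in>A. \<Sum>i\<le>n. (- 1) ^ i *
      wcoeff (take (Suc k) (drop i v)) (lie_bracket X (ncs_word [a])) * ?T i a)"
    using Suc.prems by (simp add: wcoeff_sum Suc.IH [of "Suc k"])
  also have "\<dots> = (\<Sum>i\<le>n. \<Sum>a\<in>A. (- 1) ^ i *
      wcoeff (take (Suc k) (drop i v)) (lie_bracket X (ncs_word [a])) * ?T i a)"
    by (rule sum.swap)
  also have "\<dots> = (\<Sum>i\<le>n. (- 1) ^ i * wcoeff (take k (drop i v)) X * ?T i (v ! (i + k))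
      - (- 1) ^ i * wcoeff (take k (drop (Suc i) v)) X * ?T i (v ! i))"
  proof (intro sum.cong refl)
    fix i assume "i \<in> {..n}"
    then have i: "i \<le> n" by simp
    have mem: "v ! (i + k) \<in> A" "v ! i \<in> A"
      using assms(2) Suc.prems i nth_mem [of "i + k" v] nth_mem [of i v] by auto
    have "(\<Sum>a\<in>A. (- 1) ^ i * wcoeff (take (Suc k) (drop i v)) (lie_bracket X (ncs_word [a])) * ?T i a)
      = (\<Sum>a\<in>A. (if a = v ! (i + k) then (- 1) ^ i * wcoeff (take k (drop i v)) X * ?T i a else 0) -
         (if a = v ! i then (- 1) ^ i * wcoeff (take k (drop (Suc i) v)) X * ?T i a else 0))"
      unfolding last [OF i] by (intro sum.cong refl) (auto simp: algebra_simps)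
    then show "(\<Sum>a\<in>A. (- 1) ^ i * wcoeff (take (Suc k) (drop i v)) (lie_bracket X (ncs_word [a])) * ?T i a)
      = (- 1) ^ i * wcoeff (take k (drop i v)) X * ?T i (v ! (i + k))
      - (- 1) ^ i * wcoeff (take k (drop (Suc i) v)) X * ?T i (v ! i)"
      using mem assms(1) by (simp add: sum_subtractf)
  qed
  \<comment> \<open>Now \<open>i\<close> counts the letters to the left of \<open>X\<close>: in the
    second family it rises by one, which absorbs the minus sign.\<close>
  also have "\<dots> = (\<Sum>i\<le>Suc n. (- 1) ^ i * wcoeff (take k (drop i v)) X *
       ((if i = Suc n then 0 else ?T i (v ! (i + k))) +
        (if i = 0 then 0 else ?T (i - 1) (v ! (i - 1)))))"
  proof -
    have "(\<Sum>i\<le>Suc n. (- 1) ^ i * wcoeff (take k (drop i v)) X *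
        (if i = 0 then 0 else ?T (i - 1) (v ! (i - 1)))) =
        - (\<Sum>i\<le>n. (- 1) ^ i * wcoeff (take k (drop (Suc i) v)) X * ?T i (v ! i))"
      by (subst sum.atMost_Suc_shift) (simp add: sum_negf)
    then show ?thesis
      unfolding distrib_left sum.distrib by (simp add: sum_subtractf)
  qed
  \<comment> \<open>The inner sum is the recursion of \<open>shuffle_sum\<close> on the first
    letter; a missing term means an empty factor.\<close>
  also have "\<dots> = (\<Sum>i\<le>Suc n. (- 1) ^ i * wcoeff (take k (drop i v)) X *
       shuffle_sum f (rev (take i v)) (drop (i + k) v))"
  proof (intro sum.cong arg_cong2 [where f = "(*)"] refl)
    fix i assume "i \<in> {..Suc n}"
    then have i: "i \<le> Suc n" by simp
    have 1: "drop (i + k) v = v ! (i + k) # drop (Suc (i + k)) v" if "i \<noteq> Suc n"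
      using that i Suc.prems by (simp add: Cons_nth_drop_Suc)
    have 2: "rev (take i v) = v ! (i - 1) # rev (take (i - 1) v)" if "i \<noteq> 0"
      using that i Suc.prems by (cases i) (simp_all add: take_Suc_conv_app_nth)
    show "(if i = Suc n then 0 else ?T i (v ! (i + k))) +
        (if i = 0 then 0 else ?T (i - 1) (v ! (i - 1))) =
        shuffle_sum f (rev (take i v)) (drop (i + k) v)"
    proof (cases "i = 0 \<or> i = Suc n")
      case True
      then show ?thesis
      proof
        assume "i = 0"
        then show ?thesis using 1 by simp
      next
        assume "i = Suc n"
        then show ?thesis using 2 Suc.prems by simp
      qed
    next
      case False
      then have "i \<noteq> 0" "i \<noteq> Suc n" by auto
      then show ?thesis unfolding 1 [OF \<open>i \<noteq> Suc n\<close>] 2 [OF \<open>i \<noteq> 0\<close>]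
        using 1 2 by simp
    qed
  qed
  finally show ?case .
qed simp

text \<open>By \<open>wcoeff_bracket_sum\<close> with \<open>k = 1\<close>, the left side is an
  alternating sum over the position \<open>i\<close> of the innermost letter. Each of its
  \<open>n + 1\<close> terms equals \<open>f v\<close>.\<close>

lemma dynkin_specht_wever:
  assumes "finite A" "set v \<subseteq> A" "length v = Suc n"
    and zero: "\<And>i. 0 < i \<Longrightarrow> i < length v \<Longrightarrow> shuffle_sum f (rev (take i v)) (drop i v) = 0"
  shows "(\<Sum>a\<in>A. wcoeff v (bracket_sum A n (\<lambda>w. f (a # w)) (ncs_word [a]))) = of_nat (length v) * f v"
proof -
  let ?t = "\<lambda>i a. (- 1) ^ i * shuffle_sum (\<lambda>w. f (a # w)) (rev (take i v)) (drop (Suc i) v)"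
  \<comment> \<open>consecutive terms differ by the shuffle in \<open>zero\<close>\<close>
  have const: "?t i (v ! i) = f v" if "i \<le> n" for i
    using that
  proof (induction i)
    case 0
    then show ?case using assms(3) by (simp add: Cons_nth_drop_Suc)
  next
    case (Suc i)
    have 1: "rev (take (Suc i) v) = v ! i # rev (take i v)"
      using Suc.prems assms(3) by (simp add: take_Suc_conv_app_nth)
    have 2: "drop (Suc i) v = v ! Suc i # drop (Suc (Suc i)) v"
      using Suc.prems assms(3) by (simp add: Cons_nth_drop_Suc)
    have "shuffle_sum f (rev (take (Suc i) v)) (drop (Suc i) v) =
        shuffle_sum (\<lambda>w. f (v ! i # w)) (rev (take i v)) (drop (Suc i) v) +
        shuffle_sum (\<lambda>w. f (v ! Suc i # w)) (rev (take (Suc i) v)) (drop (Suc (Suc i)) v)"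
      by (subst shuffle_sum_expand) (use 1 2 in simp_all)
    then show ?case using zero [of "Suc i"] Suc assms(3) by (simp add: add_eq_0_iff)
  qed
  have "(\<Sum>a\<in>A. wcoeff v (bracket_sum A n (\<lambda>w. f (a # w)) (ncs_word [a]))) =
      (\<Sum>a\<in>A. \<Sum>i\<le>n. if a = v ! i then ?t i a else 0)"
  proof (intro sum.cong refl)
    fix a
    have "wcoeff v (bracket_sum A n (\<lambda>w. f (a # w)) (ncs_word [a])) =
       (\<Sum>i\<le>n. (- 1) ^ i * wcoeff (take 1 (drop i v)) (ncs_word [a]) *
         shuffle_sum (\<lambda>w. f (a # w)) (rev (take i v)) (drop (i + 1) v))"
      using assms by (intro wcoeff_bracket_sum) auto
    also have "\<dots> = (\<Sum>i\<le>n. if a = v ! i then ?t i a else 0)"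
    proof (intro sum.cong refl)
      fix i assume "i \<in> {..n}"
      then have "take 1 (drop i v) = [v ! i]"
        using assms(3) by (simp add: Cons_nth_drop_Suc [symmetric])
      then show "(- 1) ^ i * wcoeff (take 1 (drop i v)) (ncs_word [a]) *
         shuffle_sum (\<lambda>w. f (a # w)) (rev (take i v)) (drop (i + 1) v) = (if a = v ! i then ?t i a else 0)"
        by simp
    qed
    finally show "wcoeff v (bracket_sum A n (\<lambda>w. f (a # w)) (ncs_word [a])) =
      (\<Sum>i\<le>n. if a = v ! i then ?t i a else 0)" .
  qed
  also have "\<dots> = (\<Sum>i\<le>n. \<Sum>a\<in>A. if a = v ! i then ?t i a else 0)"
    by (rule sum.swap)
  also have "\<dots> = (\<Sum>i\<le>n. f v)"
  proof (intro sum.cong refl)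
    fix i assume i: "i \<in> {..n}"
    then have "v ! i \<in> A" using assms(2,3) nth_mem [of i v] by auto
    then show "(\<Sum>a\<in>A. if a = v ! i then ?t i a else 0) = f v"
      using assms(1) const [of i] i by (subst sum.delta) auto
  qed
  finally show ?thesis using assms(3) by simp
qed

section \<open>Grading and self-adjointness\<close>

lemma letter_grade_pos: "valid_alphabet \<A> \<Longrightarrow> a \<in> letters \<A> \<Longrightarrow> 1 \<le> letter_grade \<A> a"
  by (cases \<A>) auto

lemma length_le_word_grade:
  assumes "valid_alphabet \<A>" "w \<in> lists (letters \<A>)"
  shows "length w \<le> word_grade \<A> w"
  using assms(2)
proof (induction w)
  case (Cons a w)
  then show ?case using letter_grade_pos [OF assms(1), of a] by (simp add: word_grade_def)
qed simp

lemma word_grade_append [simp]: "word_grade \<A> (u @ v) = word_grade \<A> u + word_grade \<A> v"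
  by (simp add: word_grade_def)

lemma word_grade_Nil [simp]: "word_grade \<A> [] = 0"
  by (simp add: word_grade_def)

lemma word_grade_rev [simp]: "word_grade \<A> (rev w) = word_grade \<A> w"
  by (simp add: word_grade_def rev_map [symmetric])

lemma word_grade_shuffles: "w \<in> shuffles u v \<Longrightarrow> word_grade \<A> w = word_grade \<A> u + word_grade \<A> v"
  by (induction u v arbitrary: w rule: shuffles.induct) (auto simp: word_grade_def)

lemma finite_letters: "finite (letters \<A>)"
  by (cases \<A>) auto

lemma finite_words_of_grade:
  assumes "valid_alphabet \<A>"
  shows "finite {w \<in> lists (letters \<A>). word_grade \<A> w = q}"
  using length_le_word_grade [OF assms]
  by (intro finite_subset [OF _ finite_lists_length_le [OF finite_letters [of \<A>], of q]]) auto

section \<open>Series supported on words over the alphabet\<close>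

lemma series_overD: "X \<in> series_over \<A> \<Longrightarrow> w \<notin> lists (letters \<A>) \<Longrightarrow> wcoeff w X = 0"
  by (auto simp: series_over_def)

lemma series_over_mult:
  assumes "X \<in> series_over \<A>" "Y \<in> series_over \<A>"
  shows "X * Y \<in> series_over \<A>"
  unfolding series_over_def
proof (intro CollectI allI impI)
  fix w assume "wcoeff w (X * Y) \<noteq> 0"
  then obtain i where "wcoeff (take i w) X * wcoeff (drop i w) Y \<noteq> 0"
    unfolding wcoeff_mult by (meson sum.neutral)
  then have "take i w @ drop i w \<in> lists (letters \<A>)"
    using assms unfolding series_over_def append_in_lists_conv by auto
  then show "w \<in> lists (letters \<A>)" by simp
qed

lemma series_over_linear:
  "0 \<in> series_over \<A>" "1 \<in> series_over \<A>"
  "X \<in> series_over \<A> \<Longrightarrow> Y \<in> series_over \<A> \<Longrightarrow> X + Y \<in> series_over \<A>"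
  "X \<in> series_over \<A> \<Longrightarrow> Y \<in> series_over \<A> \<Longrightarrow> X - Y \<in> series_over \<A>"
  "X \<in> series_over \<A> \<Longrightarrow> ncs_scale c X \<in> series_over \<A>"
  unfolding series_over_def by (force split: if_splits)+

lemma series_over_bracket:
  "X \<in> series_over \<A> \<Longrightarrow> Y \<in> series_over \<A> \<Longrightarrow> lie_bracket X Y \<in> series_over \<A>"
  by (simp add: lie_bracket_def series_over_linear series_over_mult)

lemma series_over_letter: "a \<in> letters \<A> \<Longrightarrow> ncs_word [a] \<in> series_over \<A>"
  by (auto simp: series_over_def)

lemma free_lie_series_over: "X \<in> free_lie \<A> \<Longrightarrow> X \<in> series_over \<A>"
  by (induction rule: free_lie.induct)
    (simp_all add: series_over_linear series_over_bracket series_over_letter)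

lemma free_lie_grade_series_over: "X \<in> free_lie_grade \<A> q \<Longrightarrow> X \<in> series_over \<A>"
  unfolding free_lie_grade_def
proof (induction rule: ncs.span_induct_alt)
  case (step c Y Z)
  have "Y \<in> series_over \<A>" if "lie_pure \<A> k Y" for k
    using that by induction (simp_all add: series_over_bracket series_over_letter)
  then show ?case using step by (auto intro: series_over_linear)
qed (rule series_over_linear)

lemma series_over_exp:
  assumes "X \<in> series_over \<A>" "wcoeff [] X = 0"
  shows "ncs_exp X \<in> series_over \<A>"
  unfolding series_over_def
proof (intro CollectI allI impI)
  have "X ^ n \<in> series_over \<A>" for n
    by (induction n) (simp_all add: series_over_linear series_over_mult assms(1))
  moreover fix w assume "wcoeff w (ncs_exp X) \<noteq> 0"
  then obtain n where "wcoeff w (X ^ n) / fact n \<noteq> 0"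
    unfolding wcoeff_exp [OF assms(2)] by (meson sum.neutral)
  ultimately show "w \<in> lists (letters \<A>)" by (auto simp: series_over_def)
qed

lemma exp_product_simps [simp]:
  "exp_product [] = 1"
  "exp_product (X # Xs) = exp_product Xs * ncs_exp X"
  by (simp_all add: exp_product_def)

lemma exp_product_group_like:
  assumes "set Xs \<subseteq> free_lie \<A>"
  shows "group_like (exp_product Xs) \<and> exp_product Xs \<in> series_over \<A>"
  using assms
proof (induction Xs)
  case (Cons X Xs)
  then have "primitive X" "X \<in> series_over \<A>"
    by (auto intro: free_lie_primitive free_lie_series_over)
  then show ?case using Cons
    by (simp add: group_like_mult group_like_exp series_over_mult series_over_exp primitive_def)
qed (simp add: group_like_one series_over_linear)

text \<open>The map \<sigma> of the overview. It is multiplicative because grades add under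
  concatenation.\<close>

definition grade_sign :: "alphabet \<Rightarrow> nat ncseries \<Rightarrow> nat ncseries" where
  "grade_sign \<A> X = Abs_ncs (\<lambda>w. (- 1) ^ word_grade \<A> w * wcoeff w X)"

lemma wcoeff_grade_sign [simp]: "wcoeff w (grade_sign \<A> X) = (- 1) ^ word_grade \<A> w * wcoeff w X"
  by (simp add: grade_sign_def Abs_ncs_inverse)

lemma grade_sign_one [simp]: "grade_sign \<A> 1 = 1"
  by (simp add: ncs_eq_iff)

lemma grade_sign_mult [simp]: "grade_sign \<A> (X * Y) = grade_sign \<A> X * grade_sign \<A> Y"
  unfolding ncs_eq_iff
proof
  fix w
  show "wcoeff w (grade_sign \<A> (X * Y)) = wcoeff w (grade_sign \<A> X * grade_sign \<A> Y)"
    unfolding wcoeff_grade_sign wcoeff_mult sum_distrib_left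
  proof (intro sum.cong refl)
    fix i
    show "(- 1) ^ word_grade \<A> w * (wcoeff (take i w) X * wcoeff (drop i w) Y) =
      (- 1) ^ word_grade \<A> (take i w) * wcoeff (take i w) X *
      ((- 1) ^ word_grade \<A> (drop i w) * wcoeff (drop i w) Y)"
      by (subst word_grade_take_drop [of \<A> w i]) (simp add: power_add)
  qed
qed

lemma grade_sign_power [simp]: "grade_sign \<A> (X ^ n) = grade_sign \<A> X ^ n"
  by (induction n) simp_all

lemma grade_sign_exp:
  assumes "wcoeff [] X = 0"
  shows "grade_sign \<A> (ncs_exp X) = ncs_exp (grade_sign \<A> X)"
  using assms by (simp add: ncs_eq_iff wcoeff_exp sum_distrib_left grade_sign_power [symmetric]
      del: grade_sign_power)

text \<open>Replaces the decomposition into homogeneous parts by a formula for each coefficient,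
  since a word of \<open>Y k\<close> has grade \<open>k\<close>.\<close>

lemma lie_tilde_eq:
  assumes "valid_alphabet \<A>" "X \<in> free_lie \<A>"
  shows "lie_tilde \<A> X = - grade_sign \<A> X"
proof -
  obtain m Y where Y: "\<And>k. k \<in> {1..m} \<Longrightarrow> Y k \<in> free_lie_grade \<A> k" "X = (\<Sum>k=1..m. Y k)"
    using free_lie_decomp [OF assms] by blast
  have "wcoeff w ((- 1) ^ (k + 1) * Y k) = - ((- 1) ^ word_grade \<A> w * wcoeff w (Y k))"
    if "k \<in> {1..m}" for k w
    using free_lie_grade_wcoeff [OF Y(1) [OF that], of w]
    by (cases "word_grade \<A> w = k"; cases "even k") auto
  then have "wcoeff w (\<Sum>k=1..m. (- 1) ^ (k + 1) * Y k) = wcoeff w (- grade_sign \<A> X)" for w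
    unfolding Y(2) wcoeff_simps wcoeff_grade_sign wcoeff_sum sum_distrib_left sum_negf [symmetric]
    by (intro sum.cong) auto
  then show ?thesis
    unfolding ncs_eq_iff Y(2) using lie_tilde_sum [OF Y(1)] by simp
qed

text \<open>\<open>grade_sign\<close> acts on each exponent, and the adjoint is the product of the
  inverse exponentials in reversed order, so the factors cancel from the middle outwards.\<close>

lemma exp_product_adjoint_inverse:
  assumes "valid_alphabet \<A>" "set Xs \<subseteq> free_lie \<A>"
  shows "exp_product_adjoint \<A> Xs * grade_sign \<A> (exp_product Xs) = 1"
  using assms(2)
proof (induction Xs)
  case (Cons X Xs)
  then have X: "X \<in> free_lie \<A>" "wcoeff [] X = 0"
    using free_lie_primitive by (auto simp: primitive_def)
  have "exp_product_adjoint \<A> (X # Xs) * grade_sign \<A> (exp_product (X # Xs)) =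
      ncs_exp (- grade_sign \<A> X) * (exp_product_adjoint \<A> Xs * grade_sign \<A> (exp_product Xs)) *
      ncs_exp (grade_sign \<A> X)"
    by (simp add: exp_product_adjoint_def lie_tilde_eq [OF assms(1) X(1)] grade_sign_exp X(2) mult.assoc)
  then show ?case using Cons X(2) by (simp add: exp_minus_mult_exp)
qed (simp add: exp_product_adjoint_def)

lemma grade_split_less:
  assumes "valid_alphabet \<A>" "w \<in> lists (letters \<A>)" "0 < i" "i < length w"
  shows "word_grade \<A> (take i w) < word_grade \<A> w" "word_grade \<A> (drop i w) < word_grade \<A> w"
proof -
  have "take i w @ drop i w \<in> lists (letters \<A>)" using assms(2) by simp
  then have "take i w \<in> lists (letters \<A>)" "drop i w \<in> lists (letters \<A>)"
    unfolding append_in_lists_conv by auto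
  then have "0 < word_grade \<A> (take i w)" "0 < word_grade \<A> (drop i w)"
    using length_le_word_grade [OF assms(1)] assms(3,4)
    by (metis length_take min_less_iff_conj order_less_le_trans order_less_trans)
      (metis length_drop zero_less_diff order_less_le_trans assms(4)
        \<open>drop i w \<in> lists (letters \<A>)\<close> assms(1) length_le_word_grade)
  then show "word_grade \<A> (take i w) < word_grade \<A> w" "word_grade \<A> (drop i w) < word_grade \<A> w"
    using word_grade_take_drop [of \<A> w i] by auto
qed

lemma agree_even_grade:
  assumes "valid_alphabet \<A>" "G \<in> series_over \<A>" "H \<in> series_over \<A>"
    and "wcoeff [] G = 1" "wcoeff [] H = 1"
    and "G * grade_sign \<A> G = 1" "H * grade_sign \<A> H = 1"
    and below: "\<And>v. word_grade \<A> v < word_grade \<A> w \<Longrightarrow> wcoeff v G = wcoeff v H"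
    and "even (word_grade \<A> w)"
  shows "wcoeff w G = wcoeff w H"
proof (cases "w \<in> lists (letters \<A>) \<and> w \<noteq> []")
  case True
  let ?d = "wcoeff w G - wcoeff w H"
  have "0 = wcoeff w (G * grade_sign \<A> G) - wcoeff w (H * grade_sign \<A> H)"
    using assms by simp
  \<comment> \<open>Inner cuts produce words of smaller grade, where \<open>G\<close> and
    \<open>H\<close> agree. Each end cut contributes \<open>?d\<close>, because the constant terms
    are 1 and the sign at \<open>w\<close> is even.\<close>
  also have "\<dots> = (\<Sum>i\<le>length w. (if i = 0 then ?d else 0) + (if i = length w then ?d else 0))"
    unfolding wcoeff_mult sum_subtractf [symmetric]
  proof (intro sum.cong refl)
    fix i assume "i \<in> {..length w}"
    then consider "i = 0" | "i = length w" | "0 < i" "i < length w" by fastforce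
    then show "wcoeff (take i w) G * wcoeff (drop i w) (grade_sign \<A> G) -
        wcoeff (take i w) H * wcoeff (drop i w) (grade_sign \<A> H) =
        (if i = 0 then ?d else 0) + (if i = length w then ?d else 0)"
    proof cases
      case 3
      then show ?thesis using below grade_split_less [OF assms(1), of w i] True by simp
    qed (use True assms in simp_all)
  qed
  also have "\<dots> = 2 * ?d" by (simp add: sum.distrib)
  finally show ?thesis by simp
next
  case False
  then show ?thesis using assms(4,5) series_overD [OF assms(2)] series_overD [OF assms(3)] by metis
qed

section \<open>Comparison of group-like series\<close>

text \<open>Both shuffle coefficients are products of coefficients at \<open>u\<close> and
  \<open>v\<close>, which have grade below \<open>q\<close>.\<close>

lemma shuffle_coeff_diff_zero:
  assumes "valid_alphabet \<A>" "group_like G" "group_like H"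
    and below: "\<And>w. word_grade \<A> w < q \<Longrightarrow> wcoeff w G = wcoeff w H"
    and uv: "u @ v \<in> lists (letters \<A>)" "word_grade \<A> (u @ v) = q" "u \<noteq> []" "v \<noteq> []"
  shows "shuffle_coeff (G - H) u v = 0"
proof -
  have "word_grade \<A> u < q" "word_grade \<A> v < q"
    using grade_split_less [OF assms(1) uv(1), of "length u"] uv by auto
  then show ?thesis
    using assms(2,3) below by (simp add: shuffle_coeff_linear group_like_def)
qed

lemma agree_on_lyndon:
  assumes "valid_alphabet \<A>" "group_like G" "group_like H" "G \<in> series_over \<A>" "H \<in> series_over \<A>"
    and below: "\<And>v. word_grade \<A> v < word_grade \<A> w \<Longrightarrow> wcoeff v G = wcoeff v H"
    and lyn: "\<And>v. v \<in> lyndon_words \<A> (word_grade \<A> w) \<Longrightarrow> wcoeff v (G - H) = 0"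
  shows "wcoeff w G = wcoeff w H"
proof (cases "w \<in> lists (letters \<A>) \<and> w \<noteq> []")
  case True
  define S where "S = {v \<in> lists (letters \<A>). word_grade \<A> v = word_grade \<A> w}"
  have "wcoeff w (G - H) = 0"
  proof (rule zero_if_zero_on_lyndon)
    show "finite S" unfolding S_def by (rule finite_words_of_grade [OF assms(1)])
    have "0 < word_grade \<A> w"
      using length_le_word_grade [OF assms(1)] True by (meson length_greater_0_conv less_le_trans)
    then show "[] \<notin> S" by (auto simp: S_def)
    show "w \<in> S" using True by (simp add: S_def)
    show "shuffles u v \<subseteq> S" if "u @ v \<in> S" for u v
    proof
      fix z assume z: "z \<in> shuffles u v"
      show "z \<in> S"
        using that set_shuffles [OF z] word_grade_shuffles [OF z, of \<A>]
        by (simp add: S_def in_lists_conv_set)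
    qed
    show "shuffle_coeff (G - H) u v = 0" if "u @ v \<in> S" "u \<noteq> []" "v \<noteq> []" for u v
      using that shuffle_coeff_diff_zero [OF assms(1-3) below] by (simp add: S_def)
    show "wcoeff v (G - H) = 0" if "v \<in> S" "lyndon_word v" for v
      using that lyn by (simp add: S_def lyndon_words_def)
  qed
  then show ?thesis by simp
next
  case False
  then show ?thesis
    using assms(2,3) series_overD [OF assms(4)] series_overD [OF assms(5)] unfolding group_like_def
    by metis
qed

lemma leading_term_free_lie:
  assumes "valid_alphabet \<A>" "group_like G" "group_like H" "G \<in> series_over \<A>" "H \<in> series_over \<A>"
    and below: "\<And>w. word_grade \<A> w < q \<Longrightarrow> wcoeff w G = wcoeff w H" and "1 \<le> q"
  shows "G - H \<in> grade_ideal \<A> q \<and>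
    (\<exists>\<Theta> \<in> free_lie_grade \<A> q. \<exists>R \<in> grade_ideal \<A> (q + 1). G = H + \<Theta> + R)"
proof
  have over: "G - H \<in> series_over \<A>" using assms by (simp add: series_over_linear)
  then show "G - H \<in> grade_ideal \<A> q"
    using below by (fastforce simp: grade_ideal_def not_le [symmetric])
  define A where "A = letters \<A>"
  \<comment> \<open>Cutting off to grade \<open>q\<close> makes all bracket sums homogeneous of
    grade \<open>q\<close>.\<close>
  define f where "f w = (if word_grade \<A> w = q then wcoeff w (G - H) else 0)" for w
  \<comment> \<open>Words of one grade may differ in length, so each length \<open>n + 1\<close>
    gets its own part; the scalar undoes the factor in \<open>dynkin_specht_wever\<close>.\<close>
  define part where "part n = ncs_scale (1 / of_nat (Suc n))
    (\<Sum>a\<in>A. bracket_sum A n (\<lambda>w. f (a # w)) (ncs_word [a]))" for n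
  \<comment> \<open>Letters have grade at least 1, so words of grade \<open>q\<close> have length at
    most \<open>q\<close>.\<close>
  define \<Theta> where "\<Theta> = (\<Sum>n<q. part n)"
  have "bracket_sum A n (\<lambda>w. f (a # w)) (ncs_word [a]) \<in> free_lie_grade \<A> q" if "a \<in> A" for a n
  proof (rule bracket_sum_free_lie_grade)
    show "lie_pure \<A> (letter_grade \<A> a) (ncs_word [a])" using that lie_pure.gen by (simp add: A_def)
    show "letter_grade \<A> a + word_grade \<A> w = q" if "f (a # w) \<noteq> 0" for w
      using that by (simp add: f_def word_grade_def split: if_splits)
  qed (simp add: A_def)
  then have \<Theta>: "\<Theta> \<in> free_lie_grade \<A> q"
    unfolding \<Theta>_def part_def free_lie_grade_def by (intro ncs.span_sum ncs.span_scale) auto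
  have "wcoeff w \<Theta> = wcoeff w (G - H)" if w: "word_grade \<A> w = q" "w \<in> lists (letters \<A>)" for w
  proof -
    have "w \<noteq> []" using w \<open>1 \<le> q\<close> by auto
    then obtain m where m: "length w = Suc m" by (cases w) auto
    have "m < q" using length_le_word_grade [OF assms(1) w(2)] w(1) m by simp
    have other: "wcoeff w (part n) = 0" if "n \<noteq> m" for n
    proof -
      have "wcoeff w (bracket_sum A n (\<lambda>w. f (a # w)) (ncs_word [a])) = 0" for a
        using bracket_sum_homogeneous [where X = "ncs_word [a]" and k = 1 and v = w and n = n] that m
        by (metis One_nat_def length_Cons list.size(3) plus_1_eq_Suc wcoeff_word Suc_inject)
      then show ?thesis by (simp add: part_def wcoeff_sum)
    qed
    \<comment> \<open>Reversing the prefix changes neither its letters nor its grade, so all these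
      shuffles have grade \<open>q\<close> and \<open>f\<close> agrees with \<open>G - H\<close> on
      them.\<close>
    have "shuffle_sum f (rev (take i w)) (drop i w) = 0" if i: "0 < i" "i < length w" for i
    proof -
      have g: "word_grade \<A> (rev (take i w)) + word_grade \<A> (drop i w) = q"
        using w(1) word_grade_take_drop [of \<A> w i] by simp
      have "take i w @ drop i w \<in> lists (letters \<A>)" using w(2) by simp
      then have l: "rev (take i w) @ drop i w \<in> lists (letters \<A>)"
        unfolding append_in_lists_conv by (simp add: in_lists_conv_set)
      have "shuffle_sum f (rev (take i w)) (drop i w) = shuffle_coeff (G - H) (rev (take i w)) (drop i w)"
        using g by (intro shuffle_sum_cong) (simp add: f_def word_grade_shuffles)
      also have "\<dots> = 0"
        using g l i by (intro shuffle_coeff_diff_zero [OF assms(1-3) below]) auto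
      finally show ?thesis .
    qed
    then have "(\<Sum>a\<in>A. wcoeff w (bracket_sum A m (\<lambda>w. f (a # w)) (ncs_word [a]))) = of_nat (length w) * f w"
      using w(2) m by (intro dynkin_specht_wever) (auto simp: A_def finite_letters)
    then have "wcoeff w (part m) = f w"
      using m by (simp add: part_def wcoeff_sum del: of_nat_Suc)
    moreover have "wcoeff w \<Theta> = (\<Sum>n<q. if n = m then wcoeff w (part m) else 0)"
      unfolding \<Theta>_def wcoeff_sum using other by (intro sum.cong) auto
    ultimately show ?thesis using \<open>m < q\<close> w(1) by (simp add: f_def)
  qed
  moreover have "wcoeff w \<Theta> = 0" if "word_grade \<A> w < q" for w
    using free_lie_grade_wcoeff [OF \<Theta>] that by simp
  ultimately have "wcoeff w (G - H - \<Theta>) = 0" if "word_grade \<A> w \<le> q" "w \<in> lists (letters \<A>)" for w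
    using below that by (cases "word_grade \<A> w = q") auto
  moreover have "G - H - \<Theta> \<in> series_over \<A>"
    using over free_lie_grade_series_over [OF \<Theta>] by (rule series_over_linear)
  ultimately have "G - H - \<Theta> \<in> grade_ideal \<A> (q + 1)"
    unfolding grade_ideal_def using series_overD [of "G - H - \<Theta>" \<A>] by (auto simp: not_less_eq_eq [symmetric])
  moreover have "G = H + \<Theta> + (G - H - \<Theta>)" by simp
  ultimately show "\<exists>\<Theta> \<in> free_lie_grade \<A> q. \<exists>R \<in> grade_ideal \<A> (q + 1). G = H + \<Theta> + R"
    using \<Theta> by blast
qed

theorem theorem2p3:
  fixes \<A> :: alphabet and J p :: nat
    and \<Phi> :: "nat \<Rightarrow> nat ncseries" and \<Omega> :: "nat ncseries"
  defines "P \<equiv> exp_product (map \<Phi> [1..<Suc J])"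
  assumes "valid_alphabet \<A>" and "J \<ge> 1" and "p \<ge> 1"
    and "\<And>j. j \<in> {1..J} \<Longrightarrow> \<Phi> j \<in> free_lie \<A>" and "\<Omega> \<in> free_lie \<A>"
  shows
    "((\<forall>w \<in> (\<Union>q\<in>{1..p}. lyndon_words \<A> q). wcoeff w (P - ncs_exp \<Omega>) = 0) \<longrightarrow>
        P - ncs_exp \<Omega> \<in> grade_ideal \<A> (p + 1) \<and>
        (\<exists>\<Theta> \<in> free_lie_grade \<A> (p + 1). \<exists>R \<in> grade_ideal \<A> (p + 2). P = ncs_exp \<Omega> + \<Theta> + R)) \<and>
     (exp_product_self_adjoint \<A> (map \<Phi> [1..<Suc J]) \<and> exp_product_self_adjoint \<A> [\<Omega>] \<and> even p \<and>
        (\<forall>w \<in> (\<Union>q\<in>{q. 1 \<le> q \<and> q \<le> p \<and> odd q}. lyndon_words \<A> q). wcoeff w (P - ncs_exp \<Omega>) = 0) \<longrightarrow>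
        P - ncs_exp \<Omega> \<in> grade_ideal \<A> (p + 1) \<and>
        (\<exists>\<Theta> \<in> free_lie_grade \<A> (p + 1). \<exists>R \<in> grade_ideal \<A> (p + 2). P = ncs_exp \<Omega> + \<Theta> + R))"
  proof -
  define E where "E = ncs_exp \<Omega>"
  let ?\<Phi>s = "map \<Phi> [1..<Suc J]"
  have lie: "set ?\<Phi>s \<subseteq> free_lie \<A>" using assms(5) by auto
  have P: "group_like P" "P \<in> series_over \<A>" and E: "group_like E" "E \<in> series_over \<A>"
    using exp_product_group_like [OF lie] exp_product_group_like [of "[\<Omega>]" \<A>] assms(6)
    by (simp_all add: P_def E_def)
  \<comment> \<open>Both claims are reduced to agreement of \<open>P\<close> and \<open>E\<close> up
    to grade \<open>p\<close>.\<close>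
  have concl: "P - E \<in> grade_ideal \<A> (p + 1) \<and>
      (\<exists>\<Theta> \<in> free_lie_grade \<A> (p + 1). \<exists>R \<in> grade_ideal \<A> (p + 2). P = E + \<Theta> + R)"
    if "\<And>w. word_grade \<A> w \<le> p \<Longrightarrow> wcoeff w P = wcoeff w E"
    using leading_term_free_lie [OF assms(2) P(1) E(1) P(2) E(2), of "p + 1"] that by simp
  have step: "wcoeff w P = wcoeff w E"
    if "\<And>v. word_grade \<A> v < word_grade \<A> w \<Longrightarrow> wcoeff v P = wcoeff v E"
      and "\<And>v. v \<in> lyndon_words \<A> (word_grade \<A> w) \<Longrightarrow> wcoeff v (P - E) = 0" for w
    using agree_on_lyndon [OF assms(2) P(1) E(1) P(2) E(2)] that by blast
  have a: "wcoeff w P = wcoeff w E"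
    if lyn: "\<forall>w \<in> (\<Union>q\<in>{1..p}. lyndon_words \<A> q). wcoeff w (P - E) = 0" and "word_grade \<A> w \<le> p" for w
    using that(2)
  proof (induction "word_grade \<A> w" arbitrary: w rule: less_induct)
    case less
    show ?case
    proof (cases "word_grade \<A> w = 0")
      case True
      \<comment> \<open>The hypothesis starts at grade 1; in grade 0 the condition of
        \<open>step\<close> on Lyndon words is vacuous.\<close>
      have "v \<notin> lyndon_words \<A> 0" for v
      proof
        assume "v \<in> lyndon_words \<A> 0"
        then have "v \<in> lists (letters \<A>)" "v \<noteq> []" "word_grade \<A> v = 0"
          unfolding lyndon_words_def lyndon_word_def by blast+
        then show False using length_le_word_grade [OF assms(2)] by (metis le_zero_eq length_0_conv)
      qed
      show ?thesis
        by (rule step) (use True \<open>\<And>v. v \<notin> lyndon_words \<A> 0\<close> in auto)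
    next
      case False
      then have "1 \<le> word_grade \<A> w" by simp
      then show ?thesis
        by - (rule step, use less lyn in auto)
    qed
  qed
  have b: "wcoeff w P = wcoeff w E"
    if sa: "exp_product_self_adjoint \<A> ?\<Phi>s" "exp_product_self_adjoint \<A> [\<Omega>]"
      and lyn: "\<forall>w \<in> (\<Union>q\<in>{q. 1 \<le> q \<and> q \<le> p \<and> odd q}. lyndon_words \<A> q). wcoeff w (P - E) = 0"
      and "word_grade \<A> w \<le> p" for w
    using that(4)
  proof (induction "word_grade \<A> w" arbitrary: w rule: less_induct)
    case less
    \<comment> \<open>Self-adjointness puts the product itself in place of its adjoint in
      \<open>exp_product_adjoint_inverse\<close>.\<close>
    have inv: "P * grade_sign \<A> P = 1" "E * grade_sign \<A> E = 1"
      using sa exp_product_adjoint_inverse [OF assms(2) lie]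
        exp_product_adjoint_inverse [OF assms(2), of "[\<Omega>]"] assms(6)
      by (simp_all add: exp_product_self_adjoint_def P_def E_def)
    show ?case
    \<comment> \<open>Even grades, including 0, follow from self-adjointness and the lower grades;
      odd grades use the Lyndon words.\<close>
    proof (cases "even (word_grade \<A> w)")
      case True
      then show ?thesis
        using agree_even_grade [OF assms(2) P(2) E(2) _ _ inv, of w] less P(1) E(1)
        by (auto simp: group_like_def)
    next
      case False
      then have "1 \<le> word_grade \<A> w" by (cases "word_grade \<A> w") auto
      then show ?thesis
        by - (rule step, use less lyn False in auto)
    qed
  qed
  show ?thesis
    unfolding E_def [symmetric] using concl a b by blast
qed

end
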